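(* Let $\mathcal{D}$ be a distribution over a set $\mathcal{X}\subseteq\mathbb{R}^d$, let $\mathcal{C}\subseteq\{\mathcal{X}\to\{\pm1\}\}$ be a concept class, let $\epsilon>0$ and $m_{\mathrm{conc}}\in\mathbb{N}$, and let $\mathcal{H}=\{\pm1\}^{\mathcal{X}}$ be the class of all functions $\mathcal{X}\to\{\pm1\}$. Assume: (1) ($\mathcal{L}_1$-sandwiching) the $\frac{\epsilon}{3}$-approximate $\mathcal{L}_1$-sandwiching degree of $\mathcal{C}$ with respect to $\mathcal{D}$ is at most $\ell$ with coefficient bound $B$; (2) (Chow-concentration) for any $\hat f\in\mathcal{H}$, if $X\sim\mathcal{D}^{\otimes m}$ with $m\ge m_{\mathrm{conc}}$, then with probability at least $9/10$, for all $\alpha\in\mathbb{N}^d$ with $\|\alpha\|_1\le\ell$ we have $\bigl|\mathbb{E}_{\mathbf{x}\sim\mathcal{D}}[\hat f(\mathbf{x})\mathbf{x}^\alpha]-\mathbb{E}_{\mathbf{x}\sim X}[\hat f(\mathbf{x})\mathbf{x}^\alpha]\bigr|\le\frac{\epsilon}{Bd^{2\ell}}$. Then there exists an $(\mathbf{N}_{\mathcal{C}},\epsilon)$-tester for localized discrepancy from $\mathcal{D}$ with respect to $\{\mathcal{D}\}$ that uses $m_{\mathrm{conc}}+O(1/\epsilon^2)$ samples and runs in time $\mathrm{poly}(m_{\mathrm{conc}},d^\ell,1/\epsilon)$.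
   Context: For $\mathbf{x}\in\mathbb{R}^d$ and $\alpha\in\mathbb{N}^d$ (here $\mathbb{N}$ includes $0$ for multi-indices), $\mathbf{x}^\alpha=\prod_i\mathbf{x}_i^{\alpha_i}$, $\|\alpha\|_1=\sum_i\alpha_i$, and $\mathbb{E}_{\mathbf{x}\sim X}$ denotes the empirical average over the (multi)set $X$. $\mathcal{L}_1$-sandwiching: polynomials $p_{\mathrm{up}},p_{\mathrm{down}}$ are $\epsilon$-approximate $\mathcal{L}_1$-sandwiching polynomials for $f:\mathcal{X}\to\{\pm1\}$ under $\mathcal{D}$ if $p_{\mathrm{down}}(\mathbf{x})\le f(\mathbf{x})\le p_{\mathrm{up}}(\mathbf{x})$ for all $\mathbf{x}\in\mathcal{X}$ and $\mathbb{E}_{\mathcal{D}}[p_{\mathrm{up}}-p_{\mathrm{down}}]\le\epsilon$. The $\epsilon$-approximate $\mathcal{L}_1$-sandwiching degree of $\mathcal{C}$ under $\mathcal{D}$ is at most $\ell$ with bound $B$ if every $f\in\mathcal{C}$ has such polynomials of degree at most $\ell$ whose coefficients are all bounded in absolute value by $B$. Localized discrepancy: for a neighborhood map $\mathbf{N}:\mathcal{H}\to 2^{\mathcal{C}}$ and $\hat f\in\mathcal{H}$, $\mathrm{disc}_{\hat f,\mathbf{N}}(\mathcal{D},\mathcal{D}')=\sup_{f\in\mathbf{N}(\hat f)}\bigl(\Pr_{\mathcal{D}'}[\hat f(\mathbf{x})\ne f(\mathbf{x})]-\Pr_{\mathcal{D}}[\hat f(\mathbf{x})\ne f(\mathbf{x})]\bigr)$.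 The global neighborhood is $\mathbf{N}_{\mathcal{C}}(\hat f)=\mathcal{C}$ for all $\hat f$. Tester: for a class $\mathfrak{D}$ of distributions, $\mathcal{T}$ is an $(\mathbf{N},\epsilon)$-tester for localized discrepancy from $\mathcal{D}$ with respect to $\mathfrak{D}$ if, upon receiving $\hat f\in\mathcal{H}$ and a set of i.i.d. examples from some distribution $\mathcal{D}'$ over $\mathcal{X}$: (soundness) with probability at least $3/4$, if $\mathcal{T}$ accepts then $\mathrm{disc}_{\hat f,\mathbf{N}}(\mathcal{D},\mathcal{D}')\le\epsilon$; (completeness) if $\mathcal{D}'\in\mathfrak{D}$ then $\mathcal{T}$ accepts with probability at least $3/4$.
   Formalization: Stated for d ≥ 2 (for d = 1, d^{2ℓ} = 1 and the claim fails); hypotheses f̂ are measurable and expectations assumed to exist; running time is counted on a real RAM with unit-cost access to samples, labels f̂(x), moments E_D[x^α] and Chow parameters E_D[f̂ x^α]. *)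

theory Defs
  imports "HOL-Probability.Probability"
begin

section \<open>Multivariate polynomials\<close>

text \<open>
  The dimension \<open>d\<close> has to be quantified inside the theorem (the constants hidden in the asymptotic
  bounds do not depend on it), so a point of $R^d$ is a function on \<open>nat\<close>, extensional on \<open>{..<d}\<close>.
\<close>

definition multi_indices :: "nat \<Rightarrow> nat \<Rightarrow> (nat \<Rightarrow> nat) set" where
  "multi_indices d l = {\<alpha>. (\<forall>i\<ge>d. \<alpha> i = 0) \<and> (\<Sum>i<d. \<alpha> i) \<le> l}"

definition monomial :: "nat \<Rightarrow> (nat \<Rightarrow> nat) \<Rightarrow> (nat \<Rightarrow> real) \<Rightarrow> real" where
  "monomial d \<alpha> x = (\<Prod>i<d. x i ^ \<alpha> i)"

definition mpoly :: "nat \<Rightarrow> nat \<Rightarrow> ((nat \<Rightarrow> nat) \<Rightarrow> real) \<Rightarrow> (nat \<Rightarrow> real) \<Rightarrow> real" where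
  "mpoly d l c x = (\<Sum>\<alpha>\<in>multi_indices d l. c \<alpha> * monomial d \<alpha> x)"


section \<open>Distributions and concepts\<close>

text \<open>
  The measurable structure on \<open>X\<close> may be any one for which the coordinates are measurable: the trace
  of the Borel sets, or, for instance for countable \<open>X\<close>, all subsets of \<open>X\<close>.
\<close>

definition distribution_over :: "nat \<Rightarrow> (nat \<Rightarrow> real) set \<Rightarrow> (nat \<Rightarrow> real) measure \<Rightarrow> bool" where
  "distribution_over d X D \<longleftrightarrow>
     prob_space D \<and> space D = X \<and> X \<subseteq> ({..<d} \<rightarrow>\<^sub>E UNIV) \<and>
     (\<forall>i<d. (\<lambda>x. x i) \<in> borel_measurable D)"

definition hypotheses :: "'a measure \<Rightarrow> ('a \<Rightarrow> real) set" where
  "hypotheses D = D \<rightarrow>\<^sub>M count_space {-1, 1}"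

definition l1_sandwiching ::
  "'a measure \<Rightarrow> real \<Rightarrow> ('a \<Rightarrow> real) \<Rightarrow> ('a \<Rightarrow> real) \<Rightarrow> ('a \<Rightarrow> real) \<Rightarrow> bool" where
  "l1_sandwiching D \<epsilon> p_down p_up f \<longleftrightarrow>
     (\<forall>x\<in>space D. p_down x \<le> f x \<and> f x \<le> p_up x) \<and>
     integrable D (\<lambda>x. p_up x - p_down x) \<and>
     (LINT x|D. p_up x - p_down x) \<le> \<epsilon>"

definition l1_sandwiching_degree_le ::
  "nat \<Rightarrow> (nat \<Rightarrow> real) measure \<Rightarrow> ((nat \<Rightarrow> real) \<Rightarrow> real) set \<Rightarrow> real \<Rightarrow> nat \<Rightarrow> real \<Rightarrow> bool" where
  "l1_sandwiching_degree_le d D C \<epsilon> l B \<longleftrightarrow>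
     (\<forall>f\<in>C. \<exists>a b. (\<forall>\<alpha>\<in>multi_indices d l. \<bar>a \<alpha>\<bar> \<le> B \<and> \<bar>b \<alpha>\<bar> \<le> B) \<and>
        l1_sandwiching D \<epsilon> (mpoly d l a) (mpoly d l b) f)"

definition empirical_avg :: "nat \<Rightarrow> (nat \<Rightarrow> 'a) \<Rightarrow> ('a \<Rightarrow> real) \<Rightarrow> real" where
  "empirical_avg m S g = (\<Sum>i<m. g (S i)) / real m"

text \<open>
  Integrability is stated because the expectations on the left of the deviation bound are meant to
  exist; the Bochner integral of a non-integrable function is 0.
\<close>

definition chow_concentration ::
  "nat \<Rightarrow> (nat \<Rightarrow> real) measure \<Rightarrow> nat \<Rightarrow> nat \<Rightarrow> real \<Rightarrow> bool" where
  "chow_concentration d D m_conc l \<tau> \<longleftrightarrow>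
     (\<forall>fh\<in>hypotheses D.
        (\<forall>\<alpha>\<in>multi_indices d l. integrable D (\<lambda>x. fh x * monomial d \<alpha> x)) \<and>
        (\<forall>m\<ge>m_conc.
           measure (\<Pi>\<^sub>M i\<in>{..<m}. D)
             {S \<in> space (\<Pi>\<^sub>M i\<in>{..<m}. D). \<forall>\<alpha>\<in>multi_indices d l.
                \<bar>(LINT x|D. fh x * monomial d \<alpha> x)
                  - empirical_avg m S (\<lambda>x. fh x * monomial d \<alpha> x)\<bar> \<le> \<tau>} \<ge> 9 / 10))"


section \<open>Localized discrepancy and testers\<close>

text \<open>The supremum is taken in \<open>ereal\<close>, so that it is \<open>-\<infinity>\<close> for an empty neighborhood.\<close>

definition disc ::
  "('a \<Rightarrow> real) \<Rightarrow> (('a \<Rightarrow> real) \<Rightarrow> ('a \<Rightarrow> real) set) \<Rightarrow> 'a measure \<Rightarrow> 'a measure \<Rightarrow> ereal" where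
  "disc fh N D D' =
     (SUP f\<in>N fh. ereal (measure D' {x \<in> space D'. fh x \<noteq> f x} - measure D {x \<in> space D. fh x \<noteq> f x}))"

definition global_nbhd :: "('a \<Rightarrow> real) set \<Rightarrow> ('a \<Rightarrow> real) \<Rightarrow> ('a \<Rightarrow> real) set" where
  "global_nbhd C = (\<lambda>_. C)"

text \<open>
  \<open>acc fh S\<close> says that the tester accepts on input \<open>fh\<close> and the sample \<open>S 0, \<dots>, S (m - 1)\<close>.
\<close>

definition disc_tester ::
  "('a \<Rightarrow> real) set \<Rightarrow> (('a \<Rightarrow> real) \<Rightarrow> ('a \<Rightarrow> real) set) \<Rightarrow> real \<Rightarrow> 'a measure \<Rightarrow> 'a measure set \<Rightarrow>
   nat \<Rightarrow> (('a \<Rightarrow> real) \<Rightarrow> (nat \<Rightarrow> 'a) \<Rightarrow> bool) \<Rightarrow> bool" where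
  "disc_tester H N \<epsilon> D \<DD> m acc \<longleftrightarrow>
     (\<forall>fh\<in>H. \<forall>D'. prob_space D' \<and> sets D' = sets D \<longrightarrow>
        (let P = \<Pi>\<^sub>M i\<in>{..<m}. D' in
           {S \<in> space P. acc fh S} \<in> sets P \<and>
           measure P {S \<in> space P. acc fh S \<longrightarrow> disc fh N D D' \<le> ereal \<epsilon>} \<ge> 3 / 4 \<and>
           (D' \<in> \<DD> \<longrightarrow> measure P {S \<in> space P. acc fh S} \<ge> 3 / 4)))"


section \<open>Running time: a real RAM\<close>

text \<open>
  Programs work on natural numbers (control and addressing) and on exact reals, each with
  variables and an indexable memory, all initially 0. The tester reads coordinate \<open>j\<close> of sample
  point \<open>i\<close> by \<open>Sample i j\<close> and the label that the input hypothesis gives to sample point \<open>i\<close> by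
  \<open>Label i\<close>. The reference distribution is known to the tester through its moments: the program
  writes a multi-index to the query register, one unit increment per step, and reads the expectation
  of that monomial by \<open>Moment\<close>, and of that monomial times the input hypothesis (a Chow parameter)
  by \<open>Chow\<close>.
\<close>

datatype nexp = NConst nat | NVar nat | NMem nexp | NAdd nexp nexp | NSub nexp nexp

datatype rexp = RNat nexp | RVar nat | RMem nexp
  | RAdd rexp rexp | RSub rexp rexp | RMul rexp rexp | RDiv rexp rexp
  | Sample nexp nexp | Label nexp | Moment | Chow

datatype bexp = NLess nexp nexp | RLess rexp rexp | BNot bexp | BAnd bexp bexp

datatype prog = Skip
  | NAssign nat nexp | NStore nexp nexp
  | RAssign nat rexp | RStore nexp rexp
  | QClear | QIncr nexp
  | Seq prog prog | Cond bexp prog prog | While bexp prog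

record ram_state =
  nvar :: "nat \<Rightarrow> nat"
  nmem :: "nat \<Rightarrow> nat"
  rvar :: "nat \<Rightarrow> real"
  rmem :: "nat \<Rightarrow> real"
  query :: "nat \<Rightarrow> nat"

record ram_oracle =
  sample_at :: "nat \<Rightarrow> nat \<Rightarrow> real"
  label_at :: "nat \<Rightarrow> real"
  moment_of :: "(nat \<Rightarrow> nat) \<Rightarrow> real"
  chow_of :: "(nat \<Rightarrow> nat) \<Rightarrow> real"

fun nval :: "nexp \<Rightarrow> ram_state \<Rightarrow> nat" where
  "nval (NConst k) s = k"
| "nval (NVar v) s = nvar s v"
| "nval (NMem e) s = nmem s (nval e s)"
| "nval (NAdd e e') s = nval e s + nval e' s"
| "nval (NSub e e') s = nval e s - nval e' s"

fun rval :: "ram_oracle \<Rightarrow> rexp \<Rightarrow> ram_state \<Rightarrow> real" where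
  "rval w (RNat e) s = real (nval e s)"
| "rval w (RVar v) s = rvar s v"
| "rval w (RMem e) s = rmem s (nval e s)"
| "rval w (RAdd e e') s = rval w e s + rval w e' s"
| "rval w (RSub e e') s = rval w e s - rval w e' s"
| "rval w (RMul e e') s = rval w e s * rval w e' s"
| "rval w (RDiv e e') s = rval w e s / rval w e' s"
| "rval w (Sample e e') s = sample_at w (nval e s) (nval e' s)"
| "rval w (Label e) s = label_at w (nval e s)"
| "rval w Moment s = moment_of w (query s)"
| "rval w Chow s = chow_of w (query s)"

fun bval :: "ram_oracle \<Rightarrow> bexp \<Rightarrow> ram_state \<Rightarrow> bool" where
  "bval w (NLess e e') s \<longleftrightarrow> nval e s < nval e' s"
| "bval w (RLess e e') s \<longleftrightarrow> rval w e s < rval w e' s"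
| "bval w (BNot b) s \<longleftrightarrow> \<not> bval w b s"
| "bval w (BAnd b b') s \<longleftrightarrow> bval w b s \<and> bval w b' s"

text \<open>
  Big-step semantics with step count. Every elementary command and every test costs one step,
  whatever the size of its expressions; this is harmless up to a constant factor because the
  program of a tester is one fixed program for all instances.
\<close>

inductive exec :: "ram_oracle \<Rightarrow> prog \<Rightarrow> ram_state \<Rightarrow> nat \<Rightarrow> ram_state \<Rightarrow> bool" for w where
  "exec w Skip s 1 s"
| "exec w (NAssign v e) s 1 (s\<lparr>nvar := (nvar s)(v := nval e s)\<rparr>)"
| "exec w (NStore a e) s 1 (s\<lparr>nmem := (nmem s)(nval a s := nval e s)\<rparr>)"
| "exec w (RAssign v e) s 1 (s\<lparr>rvar := (rvar s)(v := rval w e s)\<rparr>)"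
| "exec w (RStore a e) s 1 (s\<lparr>rmem := (rmem s)(nval a s := rval w e s)\<rparr>)"
| "exec w QClear s 1 (s\<lparr>query := (\<lambda>_. 0)\<rparr>)"
| "exec w (QIncr e) s 1 (s\<lparr>query := (query s)(nval e s := Suc (query s (nval e s)))\<rparr>)"
| "exec w p s t s' \<Longrightarrow> exec w q s' t' s'' \<Longrightarrow> exec w (Seq p q) s (t + t') s''"
| "bval w b s \<Longrightarrow> exec w p s t s' \<Longrightarrow> exec w (Cond b p q) s (Suc t) s'"
| "\<not> bval w b s \<Longrightarrow> exec w q s t s' \<Longrightarrow> exec w (Cond b p q) s (Suc t) s'"
| "\<not> bval w b s \<Longrightarrow> exec w (While b p) s 1 s"
| "bval w b s \<Longrightarrow> exec w p s t s' \<Longrightarrow> exec w (While b p) s' t' s'' \<Longrightarrow>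
     exec w (While b p) s (Suc (t + t')) s''"

definition tester_input :: "nat \<Rightarrow> nat \<Rightarrow> nat \<Rightarrow> real \<Rightarrow> real \<Rightarrow> ram_state" where
  "tester_input d l m \<epsilon> B =
     \<lparr>nvar = (\<lambda>_. 0)(0 := d, 1 := l, 2 := m), nmem = (\<lambda>_. 0),
      rvar = (\<lambda>_. 0)(0 := \<epsilon>, 1 := B), rmem = (\<lambda>_. 0), query = (\<lambda>_. 0)\<rparr>"

definition tester_oracle ::
  "nat \<Rightarrow> (nat \<Rightarrow> real) measure \<Rightarrow> ((nat \<Rightarrow> real) \<Rightarrow> real) \<Rightarrow> (nat \<Rightarrow> nat \<Rightarrow> real) \<Rightarrow> ram_oracle" where
  "tester_oracle d D fh S =
     \<lparr>sample_at = (\<lambda>i j. S i j), label_at = (\<lambda>i. fh (S i)),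
      moment_of = (\<lambda>\<alpha>. LINT x|D. monomial d \<alpha> x),
      chow_of = (\<lambda>\<alpha>. LINT x|D. fh x * monomial d \<alpha> x)\<rparr>"

text \<open>A run accepts if it ends with a nonzero value in number variable 0.\<close>

definition accepts ::
  "prog \<Rightarrow> nat \<Rightarrow> nat \<Rightarrow> nat \<Rightarrow> real \<Rightarrow> real \<Rightarrow> (nat \<Rightarrow> real) measure \<Rightarrow>
   ((nat \<Rightarrow> real) \<Rightarrow> real) \<Rightarrow> (nat \<Rightarrow> nat \<Rightarrow> real) \<Rightarrow> bool" where
  "accepts T d l m \<epsilon> B D fh S \<longleftrightarrow>
     (\<exists>t s. exec (tester_oracle d D fh S) T (tester_input d l m \<epsilon> B) t s \<and> nvar s 0 \<noteq> 0)"

definition runs_in_time ::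
  "prog \<Rightarrow> nat \<Rightarrow> nat \<Rightarrow> nat \<Rightarrow> real \<Rightarrow> real \<Rightarrow> (nat \<Rightarrow> real) measure \<Rightarrow>
   ((nat \<Rightarrow> real) \<Rightarrow> real) \<Rightarrow> (nat \<Rightarrow> nat \<Rightarrow> real) \<Rightarrow> real \<Rightarrow> bool" where
  "runs_in_time T d l m \<epsilon> B D fh S bound \<longleftrightarrow>
     (\<exists>t s. exec (tester_oracle d D fh S) T (tester_input d l m \<epsilon> B) t s \<and> real t \<le> bound)"

end

theory Submission
  imports Defs
begin

text \<open>
  The tester compares, for every multi-index of degree at most \<open>l\<close>, the empirical moment and the
  empirical Chow parameter of \<open>fh\<close> with those of \<open>D\<close>, with tolerance \<open>\<epsilon> / (B d\<^bsup>2l\<^esup>)\<close>.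
  Completeness is Chow-concentration for \<open>fh\<close> and for the constant 1. For soundness, a discrepancy
  above \<open>\<epsilon>\<close> is witnessed by a single concept \<open>f\<close>, so no uniform convergence over the class is
  needed: by Hoeffding's inequality \<open>O(1/\<epsilon>\<^sup>2)\<close> samples estimate the disagreement of \<open>fh\<close> and \<open>f\<close>
  under \<open>D'\<close> up to \<open>\<epsilon>/4\<close>, while the sandwiching polynomials of \<open>f\<close> and the matched parameters
  bound the empirical disagreement by the one under \<open>D\<close> plus \<open>\<epsilon>/6 + \<epsilon>/2\<close>; there are at most
  \<open>d\<^bsup>2l\<^esup>\<close> multi-indices. If \<open>\<epsilon> \<ge> 1\<close>, the discrepancy cannot exceed \<open>\<epsilon>\<close>.

  To enumerate the multi-indices on the real RAM, a number below \<open>(d + 1)\<^bsup>l\<^esup>\<close> is read as \<open>l\<close> digits in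
  base \<open>d + 1\<close>: a digit \<open>i < d\<close> stands for one factor \<open>x\<^sub>i\<close>, the digit \<open>d\<close> for no factor. For \<open>l = 0\<close> the running
  time does not depend on \<open>d\<close>, and for \<open>l > 0\<close> everything is polynomial in \<open>d\<^bsup>l\<^esup>\<close>.
\<close>

section \<open>Timed execution of RAM programs\<close>

text \<open>The existential form asserts termination, and as runs are deterministic it speaks about
  the only run. \<open>Q\<close> also receives the step count, so one derivation yields correctness
  and cost together.\<close>

definition wp :: "ram_oracle \<Rightarrow> prog \<Rightarrow> ram_state \<Rightarrow> (nat \<Rightarrow> ram_state \<Rightarrow> bool) \<Rightarrow> bool" where
  "wp w p s Q \<longleftrightarrow> (\<exists>t s'. exec w p s t s' \<and> Q t s')"

lemma exec_simps:
  "exec w Skip s t s' \<longleftrightarrow> t = 1 \<and> s' = s"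
  "exec w (NAssign v e) s t s' \<longleftrightarrow> t = 1 \<and> s' = s\<lparr>nvar := (nvar s)(v := nval e s)\<rparr>"
  "exec w (NStore a e) s t s' \<longleftrightarrow> t = 1 \<and> s' = s\<lparr>nmem := (nmem s)(nval a s := nval e s)\<rparr>"
  "exec w (RAssign v re) s t s' \<longleftrightarrow> t = 1 \<and> s' = s\<lparr>rvar := (rvar s)(v := rval w re s)\<rparr>"
  "exec w (RStore a re) s t s' \<longleftrightarrow> t = 1 \<and> s' = s\<lparr>rmem := (rmem s)(nval a s := rval w re s)\<rparr>"
  "exec w QClear s t s' \<longleftrightarrow> t = 1 \<and> s' = s\<lparr>query := (\<lambda>_. 0)\<rparr>"
  "exec w (QIncr e) s t s' \<longleftrightarrow>
     t = 1 \<and> s' = s\<lparr>query := (query s)(nval e s := Suc (query s (nval e s)))\<rparr>"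
  by (subst exec.simps; simp; fail)+

lemma exec_Seq_iff:
  "exec w (Seq p q) s t s'' \<longleftrightarrow>
     (\<exists>t1 t2 s'. exec w p s t1 s' \<and> exec w q s' t2 s'' \<and> t = t1 + t2)"
  by (subst exec.simps) auto

lemma exec_Cond_iff:
  "exec w (Cond b p q) s t s' \<longleftrightarrow> (\<exists>t'. exec w (if bval w b s then p else q) s t' s' \<and> t = Suc t')"
  by (subst exec.simps) auto

lemma exec_While_iff:
  "exec w (While b p) s t s'' \<longleftrightarrow>
     (if bval w b s
      then \<exists>t1 t2 s'. exec w p s t1 s' \<and> exec w (While b p) s' t2 s'' \<and> t = Suc (t1 + t2)
      else t = 1 \<and> s'' = s)"
  by (subst exec.simps) auto

text \<open>\<open>accepts\<close> only asks for some accepting run; determinism lets one exhibited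
  run settle acceptance either way.\<close>

lemma exec_deterministic:
  "exec w p s t s' \<Longrightarrow> exec w p s u s'' \<Longrightarrow> u = t \<and> s'' = s'"
proof (induction arbitrary: u s'' rule: exec.induct)
  case (8 p s t s' q t' s'')
  from 8(5) show ?case unfolding exec_Seq_iff using 8(3,4) by metis
next
  case (9 b s p t s' q)
  from 9(4) show ?case unfolding exec_Cond_iff using 9(1,3) by metis
next
  case (10 b s q t s' p)
  from 10(4) show ?case unfolding exec_Cond_iff using 10(1,3) by metis
next
  case (11 b s p)
  then show ?case by (subst (asm) exec_While_iff) simp
next
  case (12 b s p t s' t' s3)
  from 12(6) 12(1) obtain t1 t2 s1 where
    *: "exec w p s t1 s1" "exec w (While b p) s1 t2 s''" "u = Suc (t1 + t2)"
    unfolding exec_While_iff[of w b p s u] by auto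
  from 12(4)[OF *(1)] have "t1 = t" "s1 = s'" by auto
  with 12(5)[of t2 s''] * show ?case by simp
qed (simp_all add: exec_simps)

lemma wp_simps:
  "wp w Skip s Q \<longleftrightarrow> Q 1 s"
  "wp w (NAssign v e) s Q \<longleftrightarrow> Q 1 (s\<lparr>nvar := (nvar s)(v := nval e s)\<rparr>)"
  "wp w (RAssign v re) s Q \<longleftrightarrow> Q 1 (s\<lparr>rvar := (rvar s)(v := rval w re s)\<rparr>)"
  "wp w QClear s Q \<longleftrightarrow> Q 1 (s\<lparr>query := (\<lambda>_. 0)\<rparr>)"
  "wp w (QIncr e) s Q \<longleftrightarrow> Q 1 (s\<lparr>query := (query s)(nval e s := Suc (query s (nval e s)))\<rparr>)"
  by (simp_all add: wp_def exec_simps)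

lemma wp_Seq:
  "wp w (Seq p q) s Q \<longleftrightarrow> wp w p s (\<lambda>t s'. wp w q s' (\<lambda>t'. Q (t + t')))"
  unfolding wp_def exec_Seq_iff by blast

lemma wp_Cond:
  "wp w (Cond b p q) s Q \<longleftrightarrow> wp w (if bval w b s then p else q) s (\<lambda>t. Q (Suc t))"
  unfolding wp_def exec_Cond_iff by blast

lemma wp_mono: "wp w p s P \<Longrightarrow> (\<And>t s'. P t s' \<Longrightarrow> Q t s') \<Longrightarrow> wp w p s Q"
  unfolding wp_def by blast

text \<open>The measure \<open>\<mu>\<close> bounds the number of iterations, each paying at most
  \<open>n\<close> for the body and one for its test; the leading 1 is the final, failing
  test.\<close>

lemma wp_While:
  fixes \<mu> :: "ram_state \<Rightarrow> nat"
  assumes "I s"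
    and body: "\<And>s. I s \<Longrightarrow> bval w b s \<Longrightarrow> wp w p s (\<lambda>t s'. t \<le> n \<and> I s' \<and> \<mu> s' < \<mu> s)"
  shows "wp w (While b p) s (\<lambda>t s'. t \<le> 1 + \<mu> s * (n + 1) \<and> I s' \<and> \<not> bval w b s')"
  using \<open>I s\<close>
proof (induction "\<mu> s" arbitrary: s rule: less_induct)
  case less
  show ?case
  proof (cases "bval w b s")
    case False
    then have "exec w (While b p) s 1 s" by (rule exec.intros)
    then show ?thesis
      unfolding wp_def using False less.prems
      by (intro exI[of _ 1] exI[of _ s]) auto
  next
    case True
    from body[OF less.prems True] obtain t s' where
      1: "exec w p s t s'" "t \<le> n" "I s'" "\<mu> s' < \<mu> s"
      unfolding wp_def by blast
    from less.hyps[OF 1(4) 1(3)] obtain t' s'' where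
      2: "exec w (While b p) s' t' s''" "t' \<le> 1 + \<mu> s' * (n + 1)" "I s''" "\<not> bval w b s''"
      unfolding wp_def by blast
    have "(\<mu> s' + 1) * (n + 1) \<le> \<mu> s * (n + 1)"
      using 1(4) by (intro mult_right_mono) auto
    then have "Suc (t + t') \<le> 1 + \<mu> s * (n + 1)"
      using 1(2) 2(2) by (simp add: algebra_simps)
    moreover have "exec w (While b p) s (Suc (t + t')) s''"
      using True 1(1) 2(1) by (rule exec.intros)
    ultimately show ?thesis unfolding wp_def using 2 by blast
  qed
qed

section \<open>Enumeration of multi-indices\<close>

fun index_of_code :: "nat \<Rightarrow> nat \<Rightarrow> nat \<Rightarrow> nat \<Rightarrow> nat" where
  "index_of_code d 0 k = (\<lambda>_. 0)"
| "index_of_code d (Suc n) k =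
     (\<lambda>i. index_of_code d n (k div Suc d) i + of_bool (i = k mod Suc d \<and> i < d))"

lemma index_of_code_in_multi_indices: "index_of_code d l k \<in> multi_indices d l"
proof (induction l arbitrary: k)
  case 0
  then show ?case by (simp add: multi_indices_def)
next
  case (Suc l)
  have "(\<Sum>i<d. of_bool (i = k mod Suc d \<and> i < d)) \<le> (\<Sum>i<d. of_bool (i = k mod Suc d) :: nat)"
    by (intro sum_mono) auto
  also have "\<dots> \<le> 1"
    by (simp add: of_bool_def)
  finally show ?case
    using Suc[of "k div Suc d"] by (auto simp: multi_indices_def sum.distrib)
qed

text \<open>Induction on \<open>l\<close> by choosing the lowest digit: if the degree is already at
  most \<open>l\<close>, it is the padding digit \<open>d\<close>; otherwise some exponent is
  positive, and one factor of that variable is split off.\<close>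

lemma multi_index_has_code:
  "\<alpha> \<in> multi_indices d l \<Longrightarrow> \<exists>k < Suc d ^ l. index_of_code d l k = \<alpha>"
proof (induction l arbitrary: \<alpha>)
  case 0
  then have "\<alpha> i = 0" for i
    by (cases "i < d") (auto simp: multi_indices_def)
  then have "\<alpha> = (\<lambda>_. 0)" by blast
  then show ?case by simp
next
  case (Suc l)
  have code: "\<exists>k' < Suc d ^ Suc l. index_of_code d (Suc l) k' =
      (\<lambda>i. index_of_code d l k i + of_bool (i = r \<and> i < d))" if "k < Suc d ^ l" "r \<le> d" for k r
  proof -
    have "Suc d * (k + 1) \<le> Suc d * Suc d ^ l"
      using that by (intro mult_left_mono) auto
    then have "r + Suc d * k < Suc d ^ Suc l"
      using that(2) by (simp add: algebra_simps)
    moreover have "(r + Suc d * k) mod Suc d = r" "(r + Suc d * k) div Suc d = k"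
      using that(2) by (simp_all only: mod_mult_self2 div_mult_self2) auto
    ultimately show ?thesis by (intro exI[of _ "r + Suc d * k"]) (simp del: mult_Suc)
  qed
  show ?case
  proof (cases "\<alpha> \<in> multi_indices d l")
    case True
    from Suc.IH[OF this] obtain k where "k < Suc d ^ l" "index_of_code d l k = \<alpha>" by blast
    moreover have "(\<lambda>i. \<alpha> i + of_bool (i = d \<and> i < d)) = \<alpha>" by auto
    ultimately show ?thesis using code[of k d] by simp
  next
    case False
    then have "l < (\<Sum>i<d. \<alpha> i)" using Suc.prems by (auto simp: multi_indices_def)
    then have "(\<Sum>i<d. \<alpha> i) \<noteq> 0" by linarith
    then obtain i where i: "i < d" "\<alpha> i > 0" by (metis lessThan_iff neq0_conv sum.neutral)
    define \<beta> where "\<beta> = \<alpha>(i := \<alpha> i - 1)"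
    have \<alpha>: "\<alpha> = (\<lambda>j. \<beta> j + of_bool (j = i \<and> j < d))"
      using i by (auto simp: \<beta>_def fun_eq_iff)
    have "(\<Sum>j<d. \<alpha> j) = (\<Sum>j<d. \<beta> j) + (\<Sum>j<d. of_bool (j = i \<and> j < d))"
      by (subst \<alpha>) (simp add: sum.distrib)
    also have "(\<Sum>j<d. of_bool (j = i \<and> j < d)) = (\<Sum>j<d. if j = i then 1 else 0 :: nat)"
      by (intro sum.cong) auto
    also have "\<dots> = 1" using i by simp
    finally have "\<beta> \<in> multi_indices d l"
      using Suc.prems i by (auto simp: multi_indices_def \<beta>_def)
    from Suc.IH[OF this] obtain k where "k < Suc d ^ l" "index_of_code d l k = \<beta>" by blast
    with code[of k i] i \<alpha> show ?thesis by simp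
  qed
qed

lemma multi_indices_eq_image: "multi_indices d l = index_of_code d l ` {..<Suc d ^ l}"
  using index_of_code_in_multi_indices multi_index_has_code by fastforce

lemma finite_multi_indices: "finite (multi_indices d l)"
  by (simp add: multi_indices_eq_image)

text \<open>Rests on \<open>d + 1 \<le> 2 * d \<le> d * d\<close>. Here \<open>d \<ge> 2\<close> is
  essential: for \<open>d = 1\<close> and \<open>l > 0\<close> the claim would read
  \<open>2 ^ l \<le> 1\<close>.\<close>

lemma Suc_power_le:
  assumes "d \<ge> 2"
  shows "Suc d ^ l \<le> (d ^ l) ^ 2"
proof -
  have "Suc d \<le> d * 2" using assms by simp
  also have "\<dots> \<le> d * d" using assms by (intro mult_left_mono) auto
  finally have "Suc d ^ l \<le> (d * d) ^ l" by (intro power_mono) auto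
  then show ?thesis by (simp add: power_mult_distrib power2_eq_square)
qed

lemma card_multi_indices_le:
  assumes "d \<ge> 2"
  shows "card (multi_indices d l) \<le> d ^ (2 * l)"
proof -
  have "card (multi_indices d l) \<le> Suc d ^ l"
    unfolding multi_indices_eq_image by (metis card_image_le card_lessThan finite_lessThan)
  also note Suc_power_le[OF assms]
  finally show ?thesis by (simp add: power_mult mult.commute flip: power_mult)
qed

lemma monomial_index_of_code_Suc:
  "monomial d (index_of_code d (Suc n) k) x =
     (if k mod Suc d < d then x (k mod Suc d) else 1) * monomial d (index_of_code d n (k div Suc d)) x"
proof -
  have "(\<Prod>i<d. x i ^ of_bool (i = k mod Suc d \<and> i < d)) =
      (\<Prod>i<d. if i = k mod Suc d then x i else 1)"
    by (intro prod.cong) auto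
  then show ?thesis
    by (simp add: monomial_def power_add prod.distrib)
qed

section \<open>The tester\<close>

text \<open>Variable 0 holds the dimension during the run and the verdict at its end.\<close>

abbreviation (input) "vD \<equiv> 0 :: nat"
abbreviation (input) "vL \<equiv> 1 :: nat"
abbreviation (input) "vM \<equiv> 2 :: nat"
abbreviation (input) "vK \<equiv> 3 :: nat"
abbreviation (input) "vI \<equiv> 4 :: nat"
abbreviation (input) "vR \<equiv> 5 :: nat"
abbreviation (input) "vQ \<equiv> 6 :: nat"
abbreviation (input) "vJ \<equiv> 7 :: nat"
abbreviation (input) "vOk \<equiv> 8 :: nat"
abbreviation (input) "rEps \<equiv> 0 :: nat"
abbreviation (input) "rB \<equiv> 1 :: nat"
abbreviation (input) "rN \<equiv> 2 :: nat"
abbreviation (input) "rTol \<equiv> 3 :: nat"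
abbreviation (input) "rP \<equiv> 4 :: nat"
abbreviation (input) "rSumM \<equiv> 5 :: nat"
abbreviation (input) "rSumC \<equiv> 6 :: nat"

text \<open>The machine has no division. Subtractions and digit outputs share one loop, so a single
  measure bounds both. The action \<open>A\<close> on a digit below \<open>d\<close> is a parameter
  because writing the query and multiplying out a monomial use the same decoder.\<close>

definition digit_step :: "prog \<Rightarrow> prog" where
  "digit_step A =
     Cond (NLess (NVar vD) (NVar vR))
       (Seq (NAssign vR (NSub (NVar vR) (NAdd (NVar vD) (NConst 1))))
            (NAssign vQ (NAdd (NVar vQ) (NConst 1))))
       (Seq (Cond (NLess (NVar vR) (NVar vD)) A Skip)
       (Seq (NAssign vR (NVar vQ))
       (Seq (NAssign vQ (NConst 0))
            (NAssign vJ (NAdd (NVar vJ) (NConst 1))))))"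

definition decode :: "prog \<Rightarrow> prog" where
  "decode A =
     Seq (NAssign vR (NVar vK))
    (Seq (NAssign vQ (NConst 0))
    (Seq (NAssign vJ (NConst 0))
         (While (NLess (NVar vJ) (NVar vL)) (digit_step A))))"

definition query_prog :: prog where
  "query_prog = Seq QClear (decode (QIncr (NVar vR)))"

definition product_prog :: prog where
  "product_prog = Seq (RAssign rP (RNat (NConst 1)))
     (decode (RAssign rP (RMul (RVar rP) (Sample (NVar vI) (NVar vR)))))"

definition sums_prog :: prog where
  "sums_prog =
     Seq (RAssign rSumM (RNat (NConst 0)))
    (Seq (RAssign rSumC (RNat (NConst 0)))
    (Seq (NAssign vI (NConst 0))
         (While (NLess (NVar vI) (NVar vM))
           (Seq product_prog
           (Seq (RAssign rSumM (RAdd (RVar rSumM) (RVar rP)))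
           (Seq (RAssign rSumC (RAdd (RVar rSumC) (RMul (Label (NVar vI)) (RVar rP))))
                (NAssign vI (NAdd (NVar vI) (NConst 1)))))))))"

definition within_tol :: "rexp \<Rightarrow> rexp \<Rightarrow> bexp" where
  "within_tol e e' = BAnd (BNot (RLess (RVar rTol) (RSub e e'))) (BNot (RLess (RVar rTol) (RSub e' e)))"

text \<open>Number expressions have no multiplication, so the count of codes
  \<open>(d + 1) ^ l\<close> is built in a real register and the main loop compares against
  that.\<close>

definition params_prog :: prog where
  "params_prog =
     Seq (NAssign vJ (NConst 0))
    (Seq (RAssign rN (RNat (NConst 1)))
    (Seq (RAssign rTol (RNat (NConst 1)))
    (Seq (While (NLess (NVar vJ) (NVar vL))
           (Seq (RAssign rN (RMul (RVar rN) (RNat (NAdd (NVar vD) (NConst 1)))))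
           (Seq (RAssign rTol (RMul (RVar rTol) (RMul (RNat (NVar vD)) (RNat (NVar vD)))))
                (NAssign vJ (NAdd (NVar vJ) (NConst 1))))))
         (RAssign rTol (RDiv (RVar rEps) (RMul (RVar rB) (RVar rTol)))))))"

definition check_prog :: prog where
  "check_prog =
     Seq query_prog
    (Seq sums_prog
    (Seq (Cond (BAnd (within_tol Moment (RDiv (RVar rSumM) (RNat (NVar vM))))
                     (within_tol Chow (RDiv (RVar rSumC) (RNat (NVar vM)))))
           Skip (NAssign vOk (NConst 0)))
         (NAssign vK (NAdd (NVar vK) (NConst 1)))))"

definition tester_prog :: prog where
  "tester_prog =
     Seq params_prog
    (Seq (NAssign vOk (NConst 1))
    (Seq (NAssign vK (NConst 0))
    (Seq (While (RLess (RNat (NVar vK)) (RVar rN)) check_prog)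
         (NAssign vD (NVar vOk)))))"

section \<open>Correctness and cost of the subprograms\<close>

lemma mod_div_digit:
  fixes r q d :: nat
  assumes "r \<le> d"
  shows "(r + Suc d * q) mod Suc d = r" "(r + Suc d * q) div Suc d = q"
  using assms by (simp_all only: mod_mult_self2 div_mult_self2) auto

text \<open>The number being decoded is \<open>r + (d + 1) q\<close>: repeated subtraction moves its quotient by
  \<open>d + 1\<close> into \<open>q\<close>, and once \<open>r \<le> d\<close> the register \<open>r\<close> holds the next digit.\<close>

lemma wp_decode:
  assumes d: "nvar s0 vD = d" and l: "nvar s0 vL = l" and k: "nvar s0 vK = k" and "d > 0"
    and J0: "J l k s0"
    and J_nvar: "\<And>n v s r. J n v (s\<lparr>nvar := r\<rparr>) = J n v s"
    and A: "\<And>n v s. J (Suc n) v s \<Longrightarrow> nvar s vR = v mod Suc d \<Longrightarrow>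
        (\<forall>x. x \<notin> {vR, vQ, vJ} \<longrightarrow> nvar s x = nvar s0 x) \<Longrightarrow> v mod Suc d < d \<Longrightarrow>
        wp w A s (\<lambda>t s'. t = 1 \<and> J n (v div Suc d) s' \<and> nvar s' = nvar s)"
    and A_none: "\<And>n v s. J (Suc n) v s \<Longrightarrow> v mod Suc d = d \<Longrightarrow> J n (v div Suc d) s"
  shows "wp w (decode A) s0
    (\<lambda>t s. t \<le> 4 + (l + k) * 7 \<and> (\<exists>v. J 0 v s) \<and>
       (\<forall>x. x \<notin> {vR, vQ, vJ} \<longrightarrow> nvar s x = nvar s0 x))"
proof -
  \<comment> \<open>\<open>J n v s\<close> is the caller's invariant with \<open>n\<close> digits
    still to be read off the number \<open>v\<close>. By \<open>J_nvar\<close> it ignores the number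
    variables, so the subtractions cannot disturb it.\<close>
  define I where "I s \<longleftrightarrow> nvar s vJ \<le> l \<and>
      J (l - nvar s vJ) (nvar s vR + Suc d * nvar s vQ) s \<and>
      (\<forall>x. x \<notin> {vR, vQ, vJ} \<longrightarrow> nvar s x = nvar s0 x)" for s :: ram_state
  \<comment> \<open>A subtraction trades \<open>d + 1\<close> units of \<open>vR\<close> for one
    unit of \<open>vQ\<close>, a strict decrease since \<open>d > 0\<close>. An output discards the
    digit, moves \<open>vQ\<close> into \<open>vR\<close> and advances \<open>vJ\<close>. The
    initial value is \<open>l + k\<close>.\<close>
  define \<mu> where "\<mu> s = (l - nvar s vJ) + nvar s vR + nvar s vQ" for s :: ram_state
  have loop: "wp w (While (NLess (NVar vJ) (NVar vL)) (digit_step A)) s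
      (\<lambda>t s'. t \<le> 1 + \<mu> s * (6 + 1) \<and> I s' \<and> \<not> bval w (NLess (NVar vJ) (NVar vL)) s')"
    if "I s" for s
  proof (rule wp_While[where I = I, OF that])
    fix s assume I: "I s" and b: "bval w (NLess (NVar vJ) (NVar vL)) s"
    have fr: "\<forall>x. x \<notin> {vR, vQ, vJ} \<longrightarrow> nvar s x = nvar s0 x" using I by (simp add: I_def)
    have sd: "nvar s vD = d" and sl: "nvar s vL = l" using fr d l by auto
    obtain n where n: "l - nvar s vJ = Suc n" "l - Suc (nvar s vJ) = n" "nvar s vJ < l"
      using b sl by (cases "l - nvar s vJ") auto
    let ?v = "nvar s vR + Suc d * nvar s vQ"
    have J: "J (Suc n) ?v s" using I n by (simp add: I_def)
    show "wp w (digit_step A) s (\<lambda>t s'. t \<le> 6 \<and> I s' \<and> \<mu> s' < \<mu> s)"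
    proof (cases "d < nvar s vR")
      case True
      then have "nvar s vR - Suc d + Suc d * Suc (nvar s vQ) = ?v" by simp
      then show ?thesis
        using True J fr n sd \<open>d > 0\<close>
        by (simp add: digit_step_def wp_Cond wp_Seq wp_simps I_def \<mu>_def J_nvar del: mult_Suc mult_Suc_right)
    next
      case False
      then have r: "?v mod Suc d = nvar s vR" "?v div Suc d = nvar s vQ"
        by (auto intro!: mod_div_digit simp del: mult_Suc)
      have digit: "wp w (Cond (NLess (NVar vR) (NVar vD)) A Skip) s
          (\<lambda>t s'. t = 2 \<and> J n (nvar s vQ) s' \<and> nvar s' = nvar s)"
      proof (cases "nvar s vR < d")
        case True
        then show ?thesis using A[OF J] r fr sd
          by (auto simp: wp_Cond simp del: mult_Suc elim!: wp_mono)
      next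
        case F: False
        then show ?thesis using A_none[OF J] r fr sd False
          by (simp add: wp_Cond wp_simps del: mult_Suc)
      qed
      show ?thesis
        unfolding digit_step_def
        apply (subst wp_Cond)
        apply (simp add: False sd wp_Seq)
        apply (rule wp_mono[OF digit])
        using False fr n sd
        by (auto simp: wp_simps I_def \<mu>_def J_nvar simp del: mult_Suc)
    qed
  qed
  show ?thesis
    unfolding decode_def wp_Seq
    apply (simp add: wp_simps del: One_nat_def)
    apply (rule wp_mono[OF loop])
    subgoal using J0 d l k by (simp add: I_def J_nvar)
    subgoal for t s using d l k by (auto simp: I_def \<mu>_def)
    done
qed

lemma wp_query:
  assumes "nvar s0 vD = d" "nvar s0 vL = l" "nvar s0 vK = k" "d > 0"
  shows "wp w query_prog s0
    (\<lambda>t s. t \<le> 5 + (l + k) * 7 \<and> query s = index_of_code d l k \<and> rvar s = rvar s0 \<and>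
       (\<forall>x. x \<notin> {vR, vQ, vJ} \<longrightarrow> nvar s x = nvar s0 x))"
proof -
  \<comment> \<open>The exponents already written plus those still encoded in \<open>v\<close> stay
    constant.\<close>
  define J where "J n v s \<longleftrightarrow> rvar s = rvar s0 \<and>
      (\<forall>i. query s i + index_of_code d n v i = index_of_code d l k i)" for n v and s :: ram_state
  show ?thesis
    unfolding query_prog_def wp_Seq wp_simps
  proof (rule wp_mono[OF wp_decode[where J = J and d = d and l = l and k = k]])
    fix n v and s :: ram_state
    assume J: "J (Suc n) v s" and R: "nvar s vR = v mod Suc d" and "v mod Suc d < d"
    have *: "((query s)(v mod Suc d := Suc (query s (v mod Suc d)))) i +
        index_of_code d n (v div Suc d) i = index_of_code d l k i" for i
      using J \<open>v mod Suc d < d\<close> unfolding J_def by (cases "i = v mod Suc d") (auto dest!: spec[of _ i])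
    show "wp w (QIncr (NVar vR)) s (\<lambda>t s'. t = 1 \<and> J n (v div Suc d) s' \<and> nvar s' = nvar s)"
      using J * R by (simp add: wp_simps J_def)
  next
    fix n v and s :: ram_state
    assume "J (Suc n) v s" "v mod Suc d = d"
    then show "J n (v div Suc d) s"
      unfolding J_def by (auto simp: of_bool_def split: if_splits)
  qed (use assms in \<open>auto simp: J_def\<close>)
qed

lemma wp_product:
  assumes "nvar s0 vD = d" "nvar s0 vL = l" "nvar s0 vK = k" "nvar s0 vI = i" "d > 0"
  shows "wp w product_prog s0
    (\<lambda>t s. t \<le> 5 + (l + k) * 7 \<and> query s = query s0 \<and>
       rvar s rP = monomial d (index_of_code d l k) (sample_at w i) \<and>
       (\<forall>x. x \<noteq> rP \<longrightarrow> rvar s x = rvar s0 x) \<and>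
       (\<forall>x. x \<notin> {vR, vQ, vJ} \<longrightarrow> nvar s x = nvar s0 x))"
proof -
  \<comment> \<open>The multiplicative analogue: the factors already collected times the monomial
    still encoded in \<open>v\<close> stay constant.\<close>
  define J where "J n v s \<longleftrightarrow> query s = query s0 \<and> (\<forall>x. x \<noteq> rP \<longrightarrow> rvar s x = rvar s0 x) \<and>
      rvar s rP * monomial d (index_of_code d n v) (sample_at w i) =
        monomial d (index_of_code d l k) (sample_at w i)" for n v and s :: ram_state
  show ?thesis
    unfolding product_prog_def wp_Seq wp_simps
    apply (rule wp_mono[OF wp_decode[where J = J and d = d and l = l and k = k]])
    using assms
    by (auto simp: J_def wp_simps monomial_index_of_code_Suc monomial_def[of _ "\<lambda>_. 0"]
        simp del: index_of_code.simps(2))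
qed


definition close_to_reference :: "ram_oracle \<Rightarrow> nat \<Rightarrow> nat \<Rightarrow> real \<Rightarrow> (nat \<Rightarrow> nat) \<Rightarrow> bool" where
  "close_to_reference w d m \<tau> \<alpha> \<longleftrightarrow>
     \<bar>moment_of w \<alpha> - (\<Sum>i<m. monomial d \<alpha> (sample_at w i)) / real m\<bar> \<le> \<tau> \<and>
     \<bar>chow_of w \<alpha> - (\<Sum>i<m. label_at w i * monomial d \<alpha> (sample_at w i)) / real m\<bar> \<le> \<tau>"

lemma wp_sums:
  fixes d l k m :: nat
  defines "\<alpha> \<equiv> index_of_code d l k"
  assumes s0: "nvar s0 vD = d" "nvar s0 vL = l" "nvar s0 vK = k" "nvar s0 vM = m" and "d > 0"
  shows "wp w sums_prog s0
    (\<lambda>t s. t \<le> 4 + m * (9 + (l + k) * 7) \<and> query s = query s0 \<and>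
       rvar s rSumM = (\<Sum>i<m. monomial d \<alpha> (sample_at w i)) \<and>
       rvar s rSumC = (\<Sum>i<m. label_at w i * monomial d \<alpha> (sample_at w i)) \<and>
       (\<forall>x. x \<notin> {rP, rSumM, rSumC} \<longrightarrow> rvar s x = rvar s0 x) \<and>
       (\<forall>x. x \<notin> {vI, vR, vQ, vJ} \<longrightarrow> nvar s x = nvar s0 x))"
proof -
  define I where "I s \<longleftrightarrow> nvar s vI \<le> m \<and> query s = query s0 \<and>
       rvar s rSumM = (\<Sum>i<nvar s vI. monomial d \<alpha> (sample_at w i)) \<and>
       rvar s rSumC = (\<Sum>i<nvar s vI. label_at w i * monomial d \<alpha> (sample_at w i)) \<and>
       (\<forall>x. x \<notin> {rP, rSumM, rSumC} \<longrightarrow> rvar s x = rvar s0 x) \<and>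
       (\<forall>x. x \<notin> {vI, vR, vQ, vJ} \<longrightarrow> nvar s x = nvar s0 x)" for s :: ram_state
  define body where "body = Seq product_prog
           (Seq (RAssign rSumM (RAdd (RVar rSumM) (RVar rP)))
           (Seq (RAssign rSumC (RAdd (RVar rSumC) (RMul (Label (NVar vI)) (RVar rP))))
                (NAssign vI (NAdd (NVar vI) (NConst 1)))))"
  have loop: "wp w (While (NLess (NVar vI) (NVar vM)) body) s
      (\<lambda>t s'. t \<le> 1 + (m - nvar s vI) * (8 + (l + k) * 7 + 1) \<and> I s' \<and>
        \<not> bval w (NLess (NVar vI) (NVar vM)) s')"
    if "I s" for s
  proof (rule wp_While[where I = I and \<mu> = "\<lambda>s. m - nvar s vI", OF that])
    fix s assume I: "I s" and b: "bval w (NLess (NVar vI) (NVar vM)) s"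
    have eqs: "nvar s vD = d" "nvar s vL = l" "nvar s vK = k" "nvar s vM = m"
      using I s0 by (auto simp: I_def)
    show "wp w body s (\<lambda>t s'. t \<le> 8 + (l + k) * 7 \<and> I s' \<and> m - nvar s' vI < m - nvar s vI)"
      unfolding body_def wp_Seq
      apply (rule wp_mono[OF wp_product[OF eqs(1-3) refl \<open>d > 0\<close>]])
      using I b eqs
      by (auto simp: wp_simps I_def \<alpha>_def)
  qed
  show ?thesis
    unfolding sums_prog_def body_def[symmetric] wp_Seq
    apply (simp add: wp_simps del: One_nat_def)
    apply (rule wp_mono[OF loop])
    subgoal using s0 by (simp add: I_def)
    subgoal for t s using s0 by (auto simp: I_def)
    done
qed

text \<open>The 12 adds the fixed costs of query, sums, test and increment,
  \<open>5 + 4 + 2 + 1\<close>; the 9 per sample is rounded up to it to obtain a product.\<close>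

lemma wp_check:
  fixes d l k m :: nat
  assumes s0: "nvar s0 vD = d" "nvar s0 vL = l" "nvar s0 vK = k" "nvar s0 vM = m" and "d > 0"
  shows "wp w check_prog s0
    (\<lambda>t s. t \<le> (m + 1) * (12 + (l + k) * 7) \<and> nvar s vK = Suc k \<and>
       nvar s vOk = (if close_to_reference w d m (rvar s0 rTol) (index_of_code d l k)
         then nvar s0 vOk else 0) \<and>
       (\<forall>x\<in>{vD, vL, vM}. nvar s x = nvar s0 x) \<and>
       (\<forall>x\<in>{rN, rTol}. rvar s x = rvar s0 x))"
  unfolding check_prog_def wp_Seq
  apply (rule wp_mono[OF wp_query[OF s0(1-3) \<open>d > 0\<close>]])
  apply (rule wp_mono[OF wp_sums[where d = d and l = l and k = k and m = m]])
  using assms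
  by (auto simp: wp_Cond wp_simps within_tol_def close_to_reference_def algebra_simps)

lemma wp_params:
  assumes s0: "nvar s0 vD = d" "nvar s0 vL = l"
  shows "wp w params_prog s0
    (\<lambda>t s. t \<le> 5 + l * 4 \<and> rvar s rN = real (Suc d ^ l) \<and>
       rvar s rTol = rvar s0 rEps / (rvar s0 rB * real d ^ (2 * l)) \<and>
       (\<forall>x. x \<noteq> vJ \<longrightarrow> nvar s x = nvar s0 x))"
proof -
  define I where "I s \<longleftrightarrow> nvar s vJ \<le> l \<and> rvar s rN = real (Suc d) ^ nvar s vJ \<and>
       rvar s rTol = real d ^ (2 * nvar s vJ) \<and>
       (\<forall>x\<in>{rEps, rB}. rvar s x = rvar s0 x) \<and>
       (\<forall>x. x \<noteq> vJ \<longrightarrow> nvar s x = nvar s0 x)" for s :: ram_state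
  define body where "body =
           (Seq (RAssign rN (RMul (RVar rN) (RNat (NAdd (NVar vD) (NConst 1)))))
           (Seq (RAssign rTol (RMul (RVar rTol) (RMul (RNat (NVar vD)) (RNat (NVar vD)))))
                (NAssign vJ (NAdd (NVar vJ) (NConst 1)))))"
  have loop: "wp w (While (NLess (NVar vJ) (NVar vL)) body) s
      (\<lambda>t s'. t \<le> 1 + (l - nvar s vJ) * (3 + 1) \<and> I s' \<and>
        \<not> bval w (NLess (NVar vJ) (NVar vL)) s')"
    if "I s" for s
    by (rule wp_While[where I = I and \<mu> = "\<lambda>s. l - nvar s vJ", OF that])
      (use s0 in \<open>auto simp: I_def body_def wp_Seq wp_simps\<close>)
  show ?thesis
    unfolding params_prog_def body_def[symmetric] wp_Seq
    apply (simp add: wp_simps del: One_nat_def)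
    apply (rule wp_mono[OF loop])
    subgoal using s0 by (simp add: I_def)
    subgoal for t s using s0 by (auto simp: I_def le_antisym)
    done
qed

lemma wp_tester:
  fixes d l m :: nat and \<epsilon> B :: real
  defines "N \<equiv> Suc d ^ l" and "\<tau> \<equiv> \<epsilon> / (B * real d ^ (2 * l))"
  assumes "d > 0"
  shows "wp w tester_prog (tester_input d l m \<epsilon> B)
    (\<lambda>t s. t \<le> 9 + l * 4 + N * ((m + 1) * (12 + (l + N) * 7) + 1) \<and>
       (nvar s vD \<noteq> 0 \<longleftrightarrow> (\<forall>\<alpha>\<in>multi_indices d l. close_to_reference w d m \<tau> \<alpha>)))"
proof -
  define I where "I s \<longleftrightarrow> nvar s vK \<le> N \<and> rvar s rN = real N \<and> rvar s rTol = \<tau> \<and>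
       nvar s vD = d \<and> nvar s vL = l \<and> nvar s vM = m \<and>
       (nvar s vOk \<noteq> 0 \<longleftrightarrow> (\<forall>k<nvar s vK. close_to_reference w d m \<tau> (index_of_code d l k)))"
    for s :: ram_state
  have loop: "wp w (While (RLess (RNat (NVar vK)) (RVar rN)) check_prog) s
      (\<lambda>t s'. t \<le> 1 + (N - nvar s vK) * ((m + 1) * (12 + (l + N) * 7) + 1) \<and> I s' \<and>
        \<not> bval w (RLess (RNat (NVar vK)) (RVar rN)) s')"
    if "I s" for s
  proof (rule wp_While[where I = I and \<mu> = "\<lambda>s. N - nvar s vK", OF that])
    fix s assume I: "I s" and b: "bval w (RLess (RNat (NVar vK)) (RVar rN)) s"
    then have k: "nvar s vK < N" by (simp add: I_def)
    \<comment> \<open>Decoding by subtraction costs more for larger codes; every iteration is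
      charged the bound for \<open>N\<close>.\<close>
    have "(m + 1) * (12 + (l + nvar s vK) * 7) \<le> (m + 1) * (12 + (l + N) * 7)"
      using k by (intro mult_left_mono) auto
    then show "wp w check_prog s (\<lambda>t s'. t \<le> (m + 1) * (12 + (l + N) * 7) \<and> I s' \<and>
        N - nvar s' vK < N - nvar s vK)"
      using I k \<open>d > 0\<close>
      by (intro wp_mono[OF wp_check[where d = d and l = l and m = m and k = "nvar s vK"]])
        (auto simp: I_def less_Suc_eq)
  qed
  \<comment> \<open>Several codes may denote one multi-index, but a conjunction ignores repetitions,
    so surjectivity of the coding suffices.\<close>
  have codes: "(\<forall>k<N. close_to_reference w d m \<tau> (index_of_code d l k)) \<longleftrightarrow>
      (\<forall>\<alpha>\<in>multi_indices d l. close_to_reference w d m \<tau> \<alpha>)"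
    by (auto simp: multi_indices_eq_image N_def)
  show ?thesis
    unfolding tester_prog_def wp_Seq
    apply (rule wp_mono[OF wp_params[where d = d and l = l]])
    subgoal by (simp add: tester_input_def)
    subgoal by (simp add: tester_input_def)
    subgoal for t s
      apply (simp add: wp_simps del: One_nat_def)
      apply (rule wp_mono[OF loop])
      subgoal by (simp add: I_def N_def \<tau>_def tester_input_def)
      subgoal for t' s' using codes by (auto simp: I_def)
      done
    done
qed

section \<open>Concentration and sandwiching\<close>

text \<open>Hoeffding's inequality for the indicators of \<open>A\<close> along the coordinates.
  Only the lower tail matters, since wrong acceptance means that the sample shows too little
  disagreement.\<close>

lemma prob_empirical_frequency_le:
  fixes M :: "'a measure"
  assumes "prob_space M" and A: "A \<in> sets M" and "m > 0" and "\<delta> \<ge> 0"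
  defines "P \<equiv> \<Pi>\<^sub>M i\<in>{..<m}. M"
  shows "measure P {S \<in> space P. empirical_avg m S (indicator A) \<le> measure M A - \<delta>}
    \<le> exp (- 2 * real m * \<delta>\<^sup>2)"
proof -
  interpret M: prob_space M by fact
  interpret P: prob_space P
    unfolding P_def by (intro prob_space_PiM assms)
  define X where "X = (\<lambda>(i :: nat) S. indicator A (S i) :: real)"
  have comp [measurable]: "(\<lambda>S. S i) \<in> P \<rightarrow>\<^sub>M M" if "i < m" for i
    unfolding P_def using that by (intro measurable_component_singleton) auto
  have meas_A [measurable]: "indicator A \<in> borel_measurable M" using A by simp
  have distr: "distr P M (\<lambda>S. S i) = M" if "i < m" for i
    unfolding P_def using that assms(1) by (intro distr_PiM_component) auto
  \<comment> \<open>The joint law of the coordinates is \<open>P\<close> itself, which is the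
    product of their marginals.\<close>
  have "P.indep_vars (\<lambda>_. M) (\<lambda>i S. S i) {..<m}"
  proof (subst P.indep_vars_iff_distr_eq_PiM')
    have "distr P (\<Pi>\<^sub>M i\<in>{..<m}. M) (\<lambda>S. \<lambda>i\<in>{..<m}. S i) = distr P P (\<lambda>S. S)"
      by (intro distr_cong) (auto simp: P_def space_PiM PiE_def extensional_restrict)
    also have "\<dots> = (\<Pi>\<^sub>M i\<in>{..<m}. distr P M (\<lambda>S. S i))"
      unfolding distr_id P_def by (intro PiM_cong) (auto simp: distr[unfolded P_def])
    finally show "distr P (\<Pi>\<^sub>M i\<in>{..<m}. M) (\<lambda>S. \<lambda>i\<in>{..<m}. S i) =
        (\<Pi>\<^sub>M i\<in>{..<m}. distr P M (\<lambda>S. S i))" .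
  qed (use \<open>m > 0\<close> in auto)
  then have indep: "P.indep_vars (\<lambda>_. borel) X {..<m}"
    unfolding X_def by (rule P.indep_vars_compose2) simp
  have distr_X: "distr P borel (X i) = distr M borel (indicator A)" if "i < m" for i
  proof -
    have "distr P borel (X i) = distr (distr P M (\<lambda>S. S i)) borel (indicator A)"
      using that by (subst distr_distr) (auto simp: X_def o_def)
    then show ?thesis using distr[OF that] by simp
  qed
  have X_meas: "X 0 \<in> borel_measurable P"
    unfolding X_def using \<open>m > 0\<close> by measurable
  interpret H: Hoeffding_ineq_iid P "{..<m}" X "X 0" 0 1 "measure M A"
  proof unfold_locales
    show "distr P borel (X i) = distr P borel (X 0)" if "i \<in> {..<m}" for i
      using distr_X[of i] distr_X[of 0] that \<open>m > 0\<close> by simp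
    have "P.expectation (X 0) = integral\<^sup>L (distr P borel (X 0)) (\<lambda>x. x)"
      using X_meas by (subst integral_distr) auto
    also have "\<dots> = measure M A"
      using \<open>m > 0\<close> A by (subst distr_X) (auto simp: integral_distr)
    finally show "measure M A \<equiv> P.expectation (X 0)" by simp
  qed (use indep X_meas in \<open>auto simp: X_def indicator_def\<close>)
  show ?thesis
    using H.Hoeffding_ineq_le'[of \<delta>] \<open>m > 0\<close> \<open>\<delta> \<ge> 0\<close>
    by (simp add: empirical_avg_def X_def lessThan_empty_iff)
qed

section \<open>Algebra of empirical averages\<close>

lemma empirical_avg_mono:
  "(\<And>i. i < m \<Longrightarrow> g (S i) \<le> h (S i)) \<Longrightarrow> empirical_avg m S g \<le> empirical_avg m S h"
  unfolding empirical_avg_def by (intro divide_right_mono sum_mono) auto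

lemma empirical_avg_const: "m > 0 \<Longrightarrow> empirical_avg m S (\<lambda>_. c) = c"
  by (simp add: empirical_avg_def)

lemma empirical_avg_add:
  "empirical_avg m S (\<lambda>x. g x + h x) = empirical_avg m S g + empirical_avg m S h"
  by (simp add: empirical_avg_def sum.distrib add_divide_distrib)

lemma empirical_avg_cmult: "empirical_avg m S (\<lambda>x. c * g x) = c * empirical_avg m S g"
  by (simp add: empirical_avg_def sum_distrib_left)

lemma empirical_avg_sum:
  "empirical_avg m S (\<lambda>x. \<Sum>\<alpha>\<in>A. g \<alpha> x) = (\<Sum>\<alpha>\<in>A. empirical_avg m S (g \<alpha>))"
  unfolding empirical_avg_def sum_divide_distrib by (rule sum.swap)

section \<open>Disagreement of sign-valued functions\<close>

lemma hypotheses_cases: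
  assumes "f \<in> hypotheses D" "x \<in> space D"
  shows "f x = -1 \<or> f x = 1"
  using measurable_space[OF assms(1)[unfolded hypotheses_def] assms(2)] by simp

lemma hypotheses_measurable: "f \<in> hypotheses D \<Longrightarrow> f \<in> borel_measurable D"
  unfolding hypotheses_def
  by (rule measurable_compose[of f D "count_space {-1, 1}" "\<lambda>x. x" borel]) auto

lemma const_one_hypothesis: "(\<lambda>_. 1) \<in> hypotheses D"
  by (simp add: hypotheses_def)

lemma disagreement_sets:
  assumes "f \<in> hypotheses D" "g \<in> hypotheses D"
  shows "{x \<in> space D. f x \<noteq> g x} \<in> sets D"
  using assms[THEN hypotheses_measurable] by measurable

text \<open>For values in {-1, 1} the indicator of disagreement is
  \<open>(1 - f x * g x) / 2\<close>, so disagreement is affine in the correlation.\<close>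

lemma prob_disagreement_eq:
  assumes "prob_space D" and f: "f \<in> hypotheses D" and g: "g \<in> hypotheses D"
  shows "measure D {x \<in> space D. f x \<noteq> g x} = (1 - (LINT x|D. f x * g x)) / 2"
    and "integrable D (\<lambda>x. f x * g x)"
proof -
  interpret prob_space D by fact
  note [measurable] = hypotheses_measurable[OF f] hypotheses_measurable[OF g]
  let ?A = "{x \<in> space D. f x \<noteq> g x}"
  have A: "?A \<in> sets D" using disagreement_sets[OF f g] .
  have "\<bar>f x * g x\<bar> = 1" if "x \<in> space D" for x
    using hypotheses_cases[OF f that] hypotheses_cases[OF g that] by auto
  then show int: "integrable D (\<lambda>x. f x * g x)"
    by (intro integrable_const_bound[where B = 1]) auto
  have "measure D ?A = (LINT x|D. indicator ?A x)" using A by simp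
  also have "\<dots> = (LINT x|D. (1 - f x * g x) / 2)"
  proof (rule Bochner_Integration.integral_cong[OF refl])
    fix x assume "x \<in> space D"
    then show "indicator ?A x = (1 - f x * g x) / 2"
      using hypotheses_cases[OF f, of x] hypotheses_cases[OF g, of x] by (auto simp: indicator_def)
  qed
  also have "\<dots> = (1 - (LINT x|D. f x * g x)) / 2"
    using int by (simp add: prob_space)
  finally show "measure D ?A = (1 - (LINT x|D. f x * g x)) / 2" .
qed

text \<open>
  With \<open>u\<close> and \<open>v\<close> for the upper and lower sandwiching polynomials, \<open>q = (u - v) / 2 - fh (u + v) / 2\<close>
  equals \<open>- v\<close> where \<open>fh = 1\<close> and \<open>u\<close> where \<open>fh = -1\<close>. So it lies between \<open>- fh f\<close> and
  \<open>- fh f + u - v\<close>, while its expectations are determined by moments and Chow parameters of \<open>fh\<close>.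
\<close>

lemma empirical_disagreement_le:
  fixes D :: "(nat \<Rightarrow> real) measure"
  assumes D: "prob_space D" and fh: "fh \<in> hypotheses D" and f: "f \<in> hypotheses D"
    and coeffs: "\<forall>\<alpha>\<in>multi_indices d l. \<bar>a \<alpha>\<bar> \<le> B \<and> \<bar>b \<alpha>\<bar> \<le> B"
    and sandwich: "l1_sandwiching D \<epsilon> (mpoly d l a) (mpoly d l b) f"
    and int_M: "\<forall>\<alpha>\<in>multi_indices d l. integrable D (monomial d \<alpha>)"
    and int_C: "\<forall>\<alpha>\<in>multi_indices d l. integrable D (\<lambda>x. fh x * monomial d \<alpha> x)"
    and S: "\<forall>i<m. S i \<in> space D" and "m > 0"
    and close_M: "\<forall>\<alpha>\<in>multi_indices d l.
      \<bar>(LINT x|D. monomial d \<alpha> x) - empirical_avg m S (monomial d \<alpha>)\<bar> \<le> \<tau>"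
    and close_C: "\<forall>\<alpha>\<in>multi_indices d l.
      \<bar>(LINT x|D. fh x * monomial d \<alpha> x) - empirical_avg m S (\<lambda>x. fh x * monomial d \<alpha> x)\<bar> \<le> \<tau>"
  shows "empirical_avg m S (indicator {x \<in> space D. fh x \<noteq> f x})
    \<le> measure D {x \<in> space D. fh x \<noteq> f x} + \<epsilon> / 2 + real (card (multi_indices d l)) * (B * \<tau>) / 2"
proof -
  interpret prob_space D by fact
  let ?MI = "multi_indices d l"
  \<comment> \<open>The polynomial \<open>q\<close> regrouped by monomials: each
    \<open>\<alpha>\<close> contributes one moment and one Chow parameter.\<close>
  define g where "g \<alpha> x = (b \<alpha> - a \<alpha>) / 2 * monomial d \<alpha> x + (- (a \<alpha> + b \<alpha>) / 2) * (fh x * monomial d \<alpha> x)"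
    for \<alpha> x
  define q where "q x = (\<Sum>\<alpha>\<in>?MI. g \<alpha> x)" for x
  have q_eq: "q x = (mpoly d l b x - mpoly d l a x) / 2 - fh x * (mpoly d l b x + mpoly d l a x) / 2" for x
    unfolding q_def g_def mpoly_def
    by (simp add: sum.distrib sum_subtractf sum_divide_distrib sum_distrib_left algebra_simps
        add_divide_distrib diff_divide_distrib sum_negf)
  have sw: "mpoly d l a x \<le> f x" "f x \<le> mpoly d l b x" if "x \<in> space D" for x
    using sandwich that by (auto simp: l1_sandwiching_def)
  have lower: "- (fh x * f x) \<le> q x" if "x \<in> space D" for x
    using hypotheses_cases[OF fh that] sw[OF that] by (auto simp: q_eq field_simps)
  have upper: "q x \<le> - (fh x * f x) + (mpoly d l b x - mpoly d l a x)" if "x \<in> space D" for x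
    using hypotheses_cases[OF fh that] sw[OF that] by (auto simp: q_eq field_simps)
  have int_g: "integrable D (g \<alpha>)" if "\<alpha> \<in> ?MI" for \<alpha>
    unfolding g_def using int_M int_C that
    by (intro Bochner_Integration.integrable_add integrable_mult_right) auto
  have int_q: "integrable D q"
    unfolding q_def using int_g by (intro Bochner_Integration.integrable_sum) auto
  note dis = prob_disagreement_eq[OF D fh f]

  \<comment> \<open>The gap between the sandwiching polynomials is controlled only in expectation
    under \<open>D\<close>, so the upper bound on \<open>q\<close> is used here; the lower bound
    holds pointwise and serves on the sample.\<close>
  have "(LINT x|D. q x) \<le> (LINT x|D. - (fh x * f x) + (mpoly d l b x - mpoly d l a x))"
    using int_q dis(2) sandwich upper
    by (intro integral_mono Bochner_Integration.integrable_add Bochner_Integration.integrable_minus)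
      (auto simp: l1_sandwiching_def)
  also have "\<dots> = - (LINT x|D. fh x * f x) + (LINT x|D. mpoly d l b x - mpoly d l a x)"
    using dis(2) sandwich by (subst Bochner_Integration.integral_add) (auto simp: l1_sandwiching_def)
  also have "\<dots> \<le> - (LINT x|D. fh x * f x) + \<epsilon>"
    using sandwich by (simp add: l1_sandwiching_def)
  finally have ref: "(LINT x|D. q x) \<le> - (LINT x|D. fh x * f x) + \<epsilon>" .

  have dev: "empirical_avg m S (g \<alpha>) - (LINT x|D. g \<alpha> x) \<le> B * \<tau>" if "\<alpha> \<in> ?MI" for \<alpha>
  proof -
    define u v where "u = (b \<alpha> - a \<alpha>) / 2" and "v = - (a \<alpha> + b \<alpha>) / 2"
    define x y where "x = empirical_avg m S (monomial d \<alpha>) - (LINT x|D. monomial d \<alpha> x)"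
      and "y = empirical_avg m S (\<lambda>x. fh x * monomial d \<alpha> x) - (LINT x|D. fh x * monomial d \<alpha> x)"
    have xy: "\<bar>x\<bar> \<le> \<tau>" "\<bar>y\<bar> \<le> \<tau>"
      using close_M close_C that by (auto simp: x_def y_def abs_minus_commute)
    \<comment> \<open>In fact \<open>\<bar>u\<bar> + \<bar>v\<bar>\<close> is the larger of
      \<open>\<bar>a \<alpha>\<bar>\<close> and \<open>\<bar>b \<alpha>\<bar>\<close>, so moment and
      Chow parameter together cost \<open>B * \<tau>\<close> and not twice that.\<close>
    have "a \<alpha> = - v - u" "b \<alpha> = u - v"
      by (simp_all add: u_def v_def field_simps)
    then have "\<bar>u\<bar> + \<bar>v\<bar> \<le> B"
      using bspec[OF coeffs that] by (auto simp: abs_if split: if_splits)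
    have "(LINT x|D. g \<alpha> x) = u * (LINT x|D. monomial d \<alpha> x) + v * (LINT x|D. fh x * monomial d \<alpha> x)"
      unfolding g_def u_def v_def using int_M int_C that
      by (subst Bochner_Integration.integral_add) auto
    moreover have "empirical_avg m S (g \<alpha>) =
        u * empirical_avg m S (monomial d \<alpha>) + v * empirical_avg m S (\<lambda>x. fh x * monomial d \<alpha> x)"
      unfolding g_def u_def v_def by (subst empirical_avg_add) (simp only: empirical_avg_cmult)
    ultimately have "empirical_avg m S (g \<alpha>) - (LINT x|D. g \<alpha> x) = u * x + v * y"
      by (simp add: x_def y_def algebra_simps)
    also have "\<dots> \<le> \<bar>u\<bar> * \<bar>x\<bar> + \<bar>v\<bar> * \<bar>y\<bar>"
      by (intro add_mono) (metis abs_ge_self abs_mult)+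
    also have "\<dots> \<le> \<bar>u\<bar> * \<tau> + \<bar>v\<bar> * \<tau>"
      using xy by (intro add_mono mult_left_mono) auto
    also have "\<dots> = (\<bar>u\<bar> + \<bar>v\<bar>) * \<tau>" by (simp add: algebra_simps)
    also have "\<dots> \<le> B * \<tau>"
      using \<open>\<bar>u\<bar> + \<bar>v\<bar> \<le> B\<close> xy by (intro mult_right_mono) auto
    finally show ?thesis .
  qed
  have "empirical_avg m S q - (LINT x|D. q x) =
      (\<Sum>\<alpha>\<in>?MI. empirical_avg m S (g \<alpha>) - (LINT x|D. g \<alpha> x))"
    unfolding q_def using int_g
    by (subst Bochner_Integration.integral_sum) (auto simp: empirical_avg_sum sum_subtractf)
  also have "\<dots> \<le> real (card ?MI) * (B * \<tau>)"
    using dev by (intro sum_bounded_above) auto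
  finally have emp: "empirical_avg m S q \<le> (LINT x|D. q x) + real (card ?MI) * (B * \<tau>)" by simp

  \<comment> \<open>The indicator is \<open>(1 - fh x * f x) / 2\<close>, at most
    \<open>(1 + q x) / 2\<close>; this factor halves both error terms.\<close>
  have "empirical_avg m S (indicator {x \<in> space D. fh x \<noteq> f x})
      \<le> empirical_avg m S (\<lambda>x. 1 / 2 + 1 / 2 * q x)"
  proof (rule empirical_avg_mono)
    fix i assume "i < m"
    then have x: "S i \<in> space D" using S by blast
    show "indicator {x \<in> space D. fh x \<noteq> f x} (S i) \<le> 1 / 2 + 1 / 2 * q (S i)"
      using lower[OF x] hypotheses_cases[OF fh x] hypotheses_cases[OF f x] x
      by (auto simp: indicator_def)
  qed
  also have "\<dots> = 1 / 2 + 1 / 2 * empirical_avg m S q"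
    using \<open>m > 0\<close> by (simp only: empirical_avg_add empirical_avg_cmult empirical_avg_const)
  also have "\<dots> \<le> (1 - (LINT x|D. fh x * f x)) / 2 + \<epsilon> / 2 + real (card ?MI) * (B * \<tau>) / 2"
    using emp ref by (simp add: field_simps)
  finally show ?thesis unfolding dis(1) .
qed

section \<open>Correctness and running time\<close>

lemma tester_accepts_iff:
  fixes d l m :: nat and \<epsilon> B :: real
  assumes "d > 0"
  defines "\<tau> \<equiv> \<epsilon> / (B * real d ^ (2 * l))"
  shows "accepts tester_prog d l m \<epsilon> B D fh S \<longleftrightarrow>
    (\<forall>\<alpha>\<in>multi_indices d l.
       \<bar>(LINT x|D. monomial d \<alpha> x) - empirical_avg m S (monomial d \<alpha>)\<bar> \<le> \<tau> \<and>
       \<bar>(LINT x|D. fh x * monomial d \<alpha> x) - empirical_avg m S (\<lambda>x. fh x * monomial d \<alpha> x)\<bar> \<le> \<tau>)"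
proof -
  let ?w = "tester_oracle d D fh S"
  from wp_tester[OF assms(1), of ?w l m \<epsilon> B] obtain t s where
    1: "exec ?w tester_prog (tester_input d l m \<epsilon> B) t s"
      "nvar s vD \<noteq> 0 \<longleftrightarrow> (\<forall>\<alpha>\<in>multi_indices d l. close_to_reference ?w d m \<tau> \<alpha>)"
    unfolding wp_def \<tau>_def by blast
  have "accepts tester_prog d l m \<epsilon> B D fh S \<longleftrightarrow> nvar s vD \<noteq> 0"
    unfolding accepts_def using 1(1) exec_deterministic by metis
  then show ?thesis
    using 1(2) by (simp add: close_to_reference_def tester_oracle_def empirical_avg_def)
qed

text \<open>Everything is measured in \<open>Z\<close>: \<open>l \<le> Z\<close>,
  \<open>N \<le> Z ^ 2\<close> and \<open>m + 1 \<le> 33 * Z ^ 2\<close>, so the dominant product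
  \<open>N * m * (l + N)\<close> has degree 6.\<close>

lemma tester_runs_in_time:
  fixes \<epsilon> B :: real and m_conc :: nat
  assumes "d \<ge> 2" "\<epsilon> > 0" and m: "real m \<le> real m_conc + 32 / \<epsilon>\<^sup>2"
  shows "runs_in_time tester_prog d l m \<epsilon> B D fh S
    (real 1000 * (1 + real m_conc + real d ^ l + 1 / \<epsilon>) ^ 1000)"
proof -
  let ?w = "tester_oracle d D fh S"
  define N where "N = Suc d ^ l"
  define Z where "Z = 1 + real m_conc + real d ^ l + 1 / \<epsilon>"
  have "d > 0" using assms by simp
  from wp_tester[OF this, of ?w l m \<epsilon> B] obtain t s where
    1: "exec ?w tester_prog (tester_input d l m \<epsilon> B) t s"
      "t \<le> 9 + l * 4 + N * ((m + 1) * (12 + (l + N) * 7) + 1)"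
    unfolding wp_def N_def by blast
  have dl: "0 \<le> real d ^ l" by simp
  have e: "0 < 1 / \<epsilon>" using assms by simp
  have Z1: "1 \<le> Z" using dl e unfolding Z_def by linarith
  have Zp: "1 \<le> Z ^ n" for n using Z1 by (rule one_le_power)
  have dZ: "real d ^ l \<le> Z" using e unfolding Z_def by linarith
  have Z2: "Z \<le> Z\<^sup>2" using Z1 by (simp add: self_le_power)
  have "real N \<le> real ((d ^ l)\<^sup>2)"
    unfolding N_def using Suc_power_le[OF assms(1)] of_nat_le_iff by blast
  also have "\<dots> \<le> Z\<^sup>2" using dZ by (simp add: power_mono)
  finally have NZ: "real N \<le> Z\<^sup>2" .
  have "l \<le> d ^ l"
    using less_exp[of l] power_mono[of 2 d l] assms(1) by linarith
  then have "real l \<le> real d ^ l" by (metis of_nat_le_iff of_nat_power)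
  then have lZ: "real l \<le> Z" using dZ by linarith
  have "(1 / \<epsilon>)\<^sup>2 \<le> Z\<^sup>2"
    using e dl unfolding Z_def by (intro power_mono) auto
  then have "32 / \<epsilon>\<^sup>2 \<le> 32 * Z\<^sup>2" by (simp add: power_divide)
  moreover have "1 + real m_conc \<le> Z" using dl e unfolding Z_def by linarith
  ultimately have mZ: "real m + 1 \<le> 33 * Z\<^sup>2" using m Z2 by linarith
  have "12 + (real l + real N) * 7 \<le> 26 * Z\<^sup>2"
    unfolding distrib_right using lZ NZ Z2 Zp[of 2] by linarith
  then have "(real m + 1) * (12 + (real l + real N) * 7) \<le> (33 * Z\<^sup>2) * (26 * Z\<^sup>2)"
    using mZ by (intro mult_mono) auto
  also have "\<dots> = 858 * Z ^ 4" by (simp flip: power_add)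
  finally have "(real m + 1) * (12 + (real l + real N) * 7) + 1 \<le> 859 * Z ^ 4"
    using Zp[of 4] by linarith
  then have "real N * ((real m + 1) * (12 + (real l + real N) * 7) + 1) \<le> Z\<^sup>2 * (859 * Z ^ 4)"
    using NZ by (intro mult_mono) auto
  also have "\<dots> = 859 * Z ^ 6" by (simp flip: power_add)
  finally have main: "real N * ((real m + 1) * (12 + (real l + real N) * 7) + 1) \<le> 859 * Z ^ 6" .
  have Z6: "Z \<le> Z ^ 6" using Z1 by (simp add: self_le_power)
  have "real t \<le> real (9 + l * 4 + N * ((m + 1) * (12 + (l + N) * 7) + 1))"
    using 1(2) of_nat_le_iff by blast
  also have "\<dots> = 9 + real l * 4 + real N * ((real m + 1) * (12 + (real l + real N) * 7) + 1)"
    by (simp add: algebra_simps)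
  also have "\<dots> \<le> 1000 * Z ^ 6"
    using main lZ Z6 Zp[of 6] by linarith
  \<comment> \<open>One constant serves as factor and as exponent, hence the inflated
    exponent.\<close>
  also have "\<dots> \<le> 1000 * Z ^ 1000"
    using Z1 by (intro mult_left_mono power_increasing) auto
  finally show ?thesis
    unfolding runs_in_time_def Z_def using 1(1) by auto
qed

section \<open>Measurability, soundness and completeness\<close>

lemma monomial_measurable:
  "distribution_over d X D \<Longrightarrow> monomial d \<alpha> \<in> borel_measurable D"
  unfolding monomial_def distribution_over_def
  by (intro borel_measurable_prod borel_measurable_power) auto

lemma empirical_avg_measurable:
  assumes "g \<in> borel_measurable M"
  shows "(\<lambda>S. empirical_avg m S g) \<in> borel_measurable (\<Pi>\<^sub>M i\<in>{..<m}. M)"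
  unfolding empirical_avg_def
  by (intro borel_measurable_divide borel_measurable_sum borel_measurable_const
      measurable_compose[OF _ assms] measurable_component_singleton) auto

lemma deviation_event_sets:
  assumes "finite A" and "\<And>\<alpha>. \<alpha> \<in> A \<Longrightarrow> g \<alpha> \<in> borel_measurable M"
  shows "{S \<in> space (\<Pi>\<^sub>M i\<in>{..<m}. M). \<forall>\<alpha>\<in>A. \<bar>c \<alpha> - empirical_avg m S (g \<alpha>)\<bar> \<le> \<tau>}
    \<in> sets (\<Pi>\<^sub>M i\<in>{..<m}. M)"
proof (rule sets.sets_Collect_finite_All[OF _ assms(1)])
  fix \<alpha> assume "\<alpha> \<in> A"
  from assms(2)[OF this] have [measurable]:
    "(\<lambda>S. empirical_avg m S (g \<alpha>)) \<in> borel_measurable (\<Pi>\<^sub>M i\<in>{..<m}. M)"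
    by (rule empirical_avg_measurable)
  show "{S \<in> space (\<Pi>\<^sub>M i\<in>{..<m}. M). \<bar>c \<alpha> - empirical_avg m S (g \<alpha>)\<bar> \<le> \<tau>}
      \<in> sets (\<Pi>\<^sub>M i\<in>{..<m}. M)"
    by measurable
qed

lemma disc_le_one:
  assumes "prob_space D'"
  shows "disc fh N D D' \<le> 1"
  unfolding disc_def
proof (rule SUP_least)
  fix f
  have "measure D' {x \<in> space D'. fh x \<noteq> f x} - measure D {x \<in> space D. fh x \<noteq> f x} \<le> 1"
    using prob_space.prob_le_1[OF assms, of "{x \<in> space D'. fh x \<noteq> f x}"]
      measure_nonneg[of D "{x \<in> space D. fh x \<noteq> f x}"] by linarith
  then show "ereal (measure D' {x \<in> space D'. fh x \<noteq> f x} - measure D {x \<in> space D. fh x \<noteq> f x}) \<le> 1"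
    by simp
qed

text \<open>If \<open>B \<le> 0\<close>, both polynomials vanish and cannot enclose a value in {-1,
  1}. Positivity lets \<open>B\<close> cancel against the tolerance.\<close>

lemma coefficient_bound_pos:
  assumes "prob_space D" "f \<in> hypotheses D"
    and "\<forall>\<alpha>\<in>multi_indices d l. \<bar>a \<alpha>\<bar> \<le> B \<and> \<bar>b \<alpha>\<bar> \<le> B"
    and "l1_sandwiching D \<epsilon> (mpoly d l a) (mpoly d l b) f"
  shows "B > 0"
proof (rule ccontr)
  assume "\<not> B > 0"
  then have "a \<alpha> = 0 \<and> b \<alpha> = 0" if "\<alpha> \<in> multi_indices d l" for \<alpha>
    using assms(3) that by force
  then have "mpoly d l a x = 0" "mpoly d l b x = 0" for x
    unfolding mpoly_def by simp_all
  moreover obtain x where "x \<in> space D" using prob_space.not_empty[OF assms(1)] by blast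
  ultimately show False
    using assms(4) hypotheses_cases[OF assms(2)] unfolding l1_sandwiching_def by fastforce
qed

text \<open>Acceptance is the intersection of a moment event and a Chow event. Its probability is
  bounded below under \<open>D\<close> for completeness, and above for soundness when the
  discrepancy exceeds \<open>\<epsilon>\<close>.\<close>

lemma tester_sound_and_complete:
  fixes d l m m_conc :: nat and \<epsilon> B :: real
  assumes "d \<ge> 2" and dist: "distribution_over d X D" and C: "C \<subseteq> hypotheses D" and "\<epsilon> > 0"
    and sand: "l1_sandwiching_degree_le d D C (\<epsilon> / 3) l B"
    and conc: "chow_concentration d D m_conc l (\<epsilon> / (B * real d ^ (2 * l)))"
    and m: "m \<ge> m_conc" "\<epsilon> < 1 \<Longrightarrow> real m \<ge> 16 / \<epsilon>\<^sup>2"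
  shows "disc_tester (hypotheses D) (global_nbhd C) \<epsilon> D {D} m (accepts tester_prog d l m \<epsilon> B D)"
  unfolding disc_tester_def Let_def
proof (intro ballI allI impI; (elim conjE)?)
  fix fh D' assume fh: "fh \<in> hypotheses D" and D': "prob_space D'" and sets: "sets D' = sets D"
  define P where "P = (\<Pi>\<^sub>M i\<in>{..<m}. D')"
  define \<tau> where "\<tau> = \<epsilon> / (B * real d ^ (2 * l))"
  define MI where "MI = multi_indices d l"
  define acc where "acc = {S \<in> space P. accepts tester_prog d l m \<epsilon> B D fh S}"
  \<comment> \<open>The factor 1 makes this literally the Chow event of the constant hypothesis
    1.\<close>
  define EM where "EM = {S \<in> space P. \<forall>\<alpha>\<in>MI.
      \<bar>(LINT x|D. 1 * monomial d \<alpha> x) - empirical_avg m S (\<lambda>x. 1 * monomial d \<alpha> x)\<bar> \<le> \<tau>}"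
  define EC where "EC = {S \<in> space P. \<forall>\<alpha>\<in>MI.
      \<bar>(LINT x|D. fh x * monomial d \<alpha> x) - empirical_avg m S (\<lambda>x. fh x * monomial d \<alpha> x)\<bar> \<le> \<tau>}"
  have D: "prob_space D" using dist by (simp add: distribution_over_def)
  interpret D': prob_space D' by fact
  interpret P: prob_space P unfolding P_def by (intro prob_space_PiM D')
  have space: "space D' = space D" using sets by (rule sets_eq_imp_space_eq)
  have meas_eq: "(borel_measurable D' :: ((nat \<Rightarrow> real) \<Rightarrow> real) set) = borel_measurable D"
    using sets by (intro measurable_cong_sets) auto
  have mon: "monomial d \<alpha> \<in> borel_measurable D'" for \<alpha>
    using monomial_measurable[OF dist] meas_eq by simp
  have fhm: "fh \<in> borel_measurable D'" using hypotheses_measurable[OF fh] meas_eq by simp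
  have fin: "finite MI" unfolding MI_def by (rule finite_multi_indices)
  have EM: "EM \<in> sets P"
    unfolding EM_def P_def using mon by (intro deviation_event_sets fin) simp
  have EC: "EC \<in> sets P"
    unfolding EC_def P_def using mon fhm
    by (intro deviation_event_sets fin borel_measurable_times)
  have acc_eq: "acc = EM \<inter> EC"
    using \<open>d \<ge> 2\<close> tester_accepts_iff[where d = d and l = l and m = m]
    by (auto simp: acc_def EM_def EC_def MI_def \<tau>_def)
  have acc: "acc \<in> sets P" using acc_eq EM EC by simp

  have sound: "measure P {S \<in> space P. accepts tester_prog d l m \<epsilon> B D fh S \<longrightarrow>
      disc fh (global_nbhd C) D D' \<le> ereal \<epsilon>} \<ge> 3 / 4"
  \<comment> \<open>The discrepancy does not depend on the sample: the event is either the whole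
    space or the event of rejection.\<close>
  proof (cases "disc fh (global_nbhd C) D D' \<le> ereal \<epsilon>")
    case True
    then show ?thesis by (simp add: P.prob_space)
  next
    case False
    \<comment> \<open>This \<open>f\<close> depends on \<open>D'\<close> but not on the sample, so
      Hoeffding applies to a fixed set.\<close>
    then obtain f where f: "f \<in> C" and
      gap: "\<epsilon> < measure D' {x \<in> space D'. fh x \<noteq> f x} - measure D {x \<in> space D. fh x \<noteq> f x}"
      by (auto simp: disc_def global_nbhd_def SUP_le_iff not_le)
    have "\<epsilon> < 1" using False disc_le_one[OF D', of fh "global_nbhd C" D]
      by (metis ereal_less_eq(3) linorder_not_le one_ereal_def order_trans less_le)
    then have m16: "real m \<ge> 16 / \<epsilon>\<^sup>2" by (rule m(2))
    then have "m > 0" using \<open>\<epsilon> > 0\<close> by (intro gr0I) auto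
    have fH: "f \<in> hypotheses D" using f C by blast
    obtain a b where ab: "\<forall>\<alpha>\<in>multi_indices d l. \<bar>a \<alpha>\<bar> \<le> B \<and> \<bar>b \<alpha>\<bar> \<le> B"
      "l1_sandwiching D (\<epsilon> / 3) (mpoly d l a) (mpoly d l b) f"
      using sand f unfolding l1_sandwiching_degree_le_def by blast
    have "B > 0" by (rule coefficient_bound_pos[OF D fH ab])
    define A where "A = {x \<in> space D. fh x \<noteq> f x}"
    have A: "A \<in> sets D'" unfolding A_def sets using disagreement_sets[OF fh fH] .
    have "real (card MI) \<le> real (d ^ (2 * l))"
      unfolding MI_def of_nat_le_iff by (rule card_multi_indices_le) fact
    then have "real (card MI) * (B * \<tau>) \<le> real d ^ (2 * l) * (B * \<tau>)"
      using \<open>B > 0\<close> \<open>\<epsilon> > 0\<close> by (intro mult_right_mono) (auto simp: \<tau>_def)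
    also have "\<dots> = \<epsilon>" using \<open>B > 0\<close> \<open>d \<ge> 2\<close> by (simp add: \<tau>_def)
    finally have budget: "real (card MI) * (B * \<tau>) \<le> \<epsilon>" .
    have int: "\<forall>\<alpha>\<in>multi_indices d l. integrable D (\<lambda>x. h x * monomial d \<alpha> x)"
      if "h \<in> hypotheses D" for h
      using conc that unfolding chow_concentration_def by blast
    \<comment> \<open>Acceptance leaves a deficit of at least \<open>\<epsilon> - \<epsilon> / 6 -
      \<epsilon> / 2 = \<epsilon> / 3\<close>, of which \<open>\<epsilon> / 4\<close> is
      kept.\<close>
    have "acc \<subseteq> {S \<in> space P. empirical_avg m S (indicator A) \<le> measure D' A - \<epsilon> / 4}"
    proof safe
      fix S assume S: "S \<in> acc"
      then show SP: "S \<in> space P" by (simp add: acc_def)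
      have "empirical_avg m S (indicator A) \<le>
          measure D A + \<epsilon> / 3 / 2 + real (card MI) * (B * \<tau>) / 2"
        unfolding A_def MI_def
        using S SP acc_eq int[OF const_one_hypothesis] space
        by (intro empirical_disagreement_le[OF D fh fH ab _ int[OF fh] _ \<open>m > 0\<close>])
          (auto simp: EM_def EC_def MI_def P_def space_PiM PiE_iff)
      then show "empirical_avg m S (indicator A) \<le> measure D' A - \<epsilon> / 4"
        using budget gap \<open>\<epsilon> > 0\<close> space by (simp add: A_def)
    qed
    then have "measure P acc \<le>
        measure P {S \<in> space P. empirical_avg m S (indicator A) \<le> measure D' A - \<epsilon> / 4}"
      unfolding P_def
      using empirical_avg_measurable[of "indicator A" D' m] A
      by (intro P.finite_measure_mono[unfolded P_def] borel_measurable_le) auto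
    also have "\<dots> \<le> exp (- 2 * real m * (\<epsilon> / 4)\<^sup>2)"
      unfolding P_def by (rule prob_empirical_frequency_le[OF D' A \<open>m > 0\<close>]) (use \<open>\<epsilon> > 0\<close> in simp)
    also have "\<dots> \<le> exp (- 2)"
    proof -
      have "16 \<le> real m * \<epsilon>\<^sup>2" using m16 \<open>\<epsilon> > 0\<close> by (simp add: field_simps)
      then show ?thesis by (simp add: power_divide)
    qed
    also have "\<dots> \<le> 1 / 4"
    proof -
      have "2 * 2 \<le> exp 1 * exp (1 :: real)"
        using exp_ge_add_one_self[of 1] by (intro mult_mono) auto
      then show ?thesis by (simp add: exp_minus field_simps flip: exp_add)
    qed
    finally have "measure P (space P - acc) \<ge> 3 / 4"
      using P.prob_compl[OF acc] by simp
    also have "space P - acc = {S \<in> space P. accepts tester_prog d l m \<epsilon> B D fh S \<longrightarrow>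
        disc fh (global_nbhd C) D D' \<le> ereal \<epsilon>}"
      using False by (auto simp: acc_def)
    finally show ?thesis .
  qed

  \<comment> \<open>Two events of probability at least 9/10 meet with probability at least
    4/5.\<close>
  have complete: "measure P acc \<ge> 3 / 4" if "D' \<in> {D}"
  proof -
    have "measure P EM \<ge> 9 / 10"
      using conc const_one_hypothesis[of D] m(1) that
      unfolding chow_concentration_def EM_def P_def MI_def \<tau>_def by fast
    moreover have "measure P EC \<ge> 9 / 10"
      using conc fh m(1) that unfolding chow_concentration_def EC_def P_def MI_def \<tau>_def by fast
    moreover have "measure P (EM \<union> EC) = measure P EM + measure P EC - measure P (EM \<inter> EC)"
      using EM EC by (intro measure_Un3) (auto simp: P.fmeasurable_eq_sets)
    moreover have "measure P (EM \<union> EC) \<le> 1" by (rule P.prob_le_1)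
    ultimately show ?thesis unfolding acc_eq by linarith
  qed

  show "{S \<in> space (\<Pi>\<^sub>M i\<in>{..<m}. D'). accepts tester_prog d l m \<epsilon> B D fh S}
        \<in> sets (\<Pi>\<^sub>M i\<in>{..<m}. D') \<and>
      3 / 4 \<le> measure (\<Pi>\<^sub>M i\<in>{..<m}. D') {S \<in> space (\<Pi>\<^sub>M i\<in>{..<m}. D').
        accepts tester_prog d l m \<epsilon> B D fh S \<longrightarrow> disc fh (global_nbhd C) D D' \<le> ereal \<epsilon>} \<and>
      (D' \<in> {D} \<longrightarrow> 3 / 4 \<le> measure (\<Pi>\<^sub>M i\<in>{..<m}. D') {S \<in> space (\<Pi>\<^sub>M i\<in>{..<m}. D').
        accepts tester_prog d l m \<epsilon> B D fh S})"
    using acc sound complete unfolding acc_def P_def by blast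
qed

theorem theorem4p3:
  "\<exists>(K :: real) (c :: nat) (T :: prog).
     \<forall>(d :: nat) (X :: (nat \<Rightarrow> real) set) (D :: (nat \<Rightarrow> real) measure)
      (C :: ((nat \<Rightarrow> real) \<Rightarrow> real) set) (\<epsilon> :: real) (m_conc :: nat) (l :: nat) (B :: real).
       d \<ge> 2 \<and> distribution_over d X D \<and> C \<subseteq> hypotheses D \<and> \<epsilon> > 0 \<and>
       l1_sandwiching_degree_le d D C (\<epsilon> / 3) l B \<and>
       chow_concentration d D m_conc l (\<epsilon> / (B * real d ^ (2 * l)))
       \<longrightarrow>
       (\<exists>m. real m \<le> real m_conc + K / \<epsilon>\<^sup>2 \<and>
          disc_tester (hypotheses D) (global_nbhd C) \<epsilon> D {D} m (accepts T d l m \<epsilon> B D) \<and>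
          (\<forall>fh\<in>hypotheses D. \<forall>S\<in>{..<m} \<rightarrow>\<^sub>E X.
             runs_in_time T d l m \<epsilon> B D fh S
               (real c * (1 + real m_conc + real d ^ l + 1 / \<epsilon>) ^ c)))"
proof (rule exI[of _ 32], rule exI[of _ 1000], rule exI[of _ tester_prog],
    intro allI impI, elim conjE)
  fix d X D C and \<epsilon> :: real and m_conc l B
  assume asm: "d \<ge> 2" "distribution_over d X D" "C \<subseteq> hypotheses D" "\<epsilon> > 0"
    "l1_sandwiching_degree_le d D C (\<epsilon> / 3) l B"
    "chow_concentration d D m_conc l (\<epsilon> / (B * real d ^ (2 * l)))"
  \<comment> \<open>Soundness asks for \<open>16 / \<epsilon>\<^sup>2\<close> samples when
    \<open>\<epsilon> < 1\<close>; doubling this absorbs the sample lost by rounding down, as then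
    \<open>16 / \<epsilon>\<^sup>2 \<ge> 1\<close>.\<close>
  define m where "m = m_conc + nat \<lfloor>32 / \<epsilon>\<^sup>2\<rfloor>"
  have fl: "real (nat \<lfloor>32 / \<epsilon>\<^sup>2\<rfloor>) \<le> 32 / \<epsilon>\<^sup>2" "32 / \<epsilon>\<^sup>2 - 1 \<le> real (nat \<lfloor>32 / \<epsilon>\<^sup>2\<rfloor>)"
    by (simp_all add: of_nat_floor)
  have m_le: "real m \<le> real m_conc + 32 / \<epsilon>\<^sup>2" using fl(1) by (simp add: m_def)
  have m_ge: "real m \<ge> 16 / \<epsilon>\<^sup>2" if "\<epsilon> < 1"
  proof -
    have "\<epsilon>\<^sup>2 \<le> 1" using that asm(4) by (simp add: power_le_one)
    then have "16 / \<epsilon>\<^sup>2 \<ge> 1" using asm(4) by (simp add: field_simps)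
    moreover have "32 / \<epsilon>\<^sup>2 = 16 / \<epsilon>\<^sup>2 + 16 / \<epsilon>\<^sup>2" by simp
    moreover have "real (nat \<lfloor>32 / \<epsilon>\<^sup>2\<rfloor>) \<le> real m" by (simp add: m_def)
    ultimately show ?thesis using fl(2) by linarith
  qed
  have "disc_tester (hypotheses D) (global_nbhd C) \<epsilon> D {D} m (accepts tester_prog d l m \<epsilon> B D)"
    using m_ge by (intro tester_sound_and_complete[OF asm]) (auto simp: m_def)
  then show "\<exists>m. real m \<le> real m_conc + 32 / \<epsilon>\<^sup>2 \<and>
      disc_tester (hypotheses D) (global_nbhd C) \<epsilon> D {D} m (accepts tester_prog d l m \<epsilon> B D) \<and>
      (\<forall>fh\<in>hypotheses D. \<forall>S\<in>{..<m} \<rightarrow>\<^sub>E X. runs_in_time tester_prog d l m \<epsilon> B D fh S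
        (real 1000 * (1 + real m_conc + real d ^ l + 1 / \<epsilon>) ^ 1000))"
    using m_le tester_runs_in_time[OF asm(1,4) m_le] by blast
qed

end
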